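(* Let $p_1<p_2<\cdots<p_s$ be primes, $e_1,\dots,e_s$ and $n$ positive integers, $G$ a finite cyclic group with $G\cong C_{p_1^{e_1}}\oplus\cdots\oplus C_{p_s^{e_s}}$, and $F$ a field containing a primitive $|G|$-th root of $1$. Let $\mathcal N(G,n)$ be the number of isomorphism classes of element systems with characters over $G$ (with values in $F$) indexed by $\{1,\dots,n\}$. Below, $\sum_\lambda$ is the sum over all $n$-tuples $\lambda=(\lambda_1,\dots,\lambda_n)$ of non-negative integers with $\lambda_1+2\lambda_2+\cdots+n\lambda_n=n$, and the exponents $f_{p,e}^{(k,d)}(\lambda)$ are as defined in the context. (i) If all of $p_1,\dots,p_s$ are odd, or $p_1=2$ and $e_1\le 2$, then $$\mathcal N(G,n)=\sum_{\lambda}\left(\frac{1}{\lambda_1!\cdots\lambda_n!\,1^{\lambda_1}\cdots n^{\lambda_n}}\prod_{i=1}^{s}\frac{\sum_{k_i=1}^{e_i}\sum_{d_i\mid p_i-1}\varphi(p_i^{e_i-k_i}d_i)\,p_i^{2f_{p_i,e_i}^{(k_i,d_i)}(\lambda)}}{p_i^{e_i-1}(p_i-1)}\right).$$ (ii) If $p_1=2$ and $e_1\ge3$, then $$\mathcal N(G,n)=\sum_{\lambda}\left(\frac{1}{\lambda_1!\cdots\lambda_n!\,1^{\lambda_1}\cdots n^{\lambda_n}}\cdot\frac{\sum_{k_1=2}^{e_1}\sum_{d_1=1}^{2}\varphi(2^{e_1-k_1})\,4^{f_{2,e_1}^{(k_1,d_1)}(\lambda)}}{2^{e_1-1}}\cdot\prod_{i=2}^{s}\frac{\sum_{k_i=1}^{e_i}\sum_{d_i\mid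 p_i-1}\varphi(p_i^{e_i-k_i}d_i)\,p_i^{2f_{p_i,e_i}^{(k_i,d_i)}(\lambda)}}{p_i^{e_i-1}(p_i-1)}\right).$$
   Context: For a finite abelian group $G$ of order $m$ and a field $F$ containing a primitive $m$-th root of $1$, $\widehat G$ denotes the set of characters of $G$, i.e. group homomorphisms $G\to F\setminus\{0\}$. An element system with characters (ESC) over $G$ indexed by a set $J$ is a pair of families $(g_i)_{i\in J}$, $(\chi_i)_{i\in J}$ with $g_i\in G$, $\chi_i\in\widehat G$. Two ESCs $(g_i,\chi_i)_{i\in J}$ over $G$ and $(g_i',\chi_i')_{i\in J'}$ over $G'$ are isomorphic if there are a group isomorphism $\phi:G\to G'$ and a bijection $\sigma:J\to J'$ such that $\phi(g_i)=g'_{\sigma(i)}$ and $\chi'_{\sigma(i)}\circ\phi=\chi_i$ for all $i\in J$. For a positive integer $n$, $\mathcal N(G,n)$ is the number of isomorphism classes of ESCs over $G$ indexed by $J=\{1,\dots,n\}$. $C_m$ is the cyclic group of order $m$, $\varphi$ is Euler's totient function, $[x]$ is the integer part of $x$, $(a,b)$ is the gcd, empty sums are $0$ and empty products are $1$. Definition of the exponents, for $\lambda=(\lambda_1,\dots,\lambda_n)$: If $p$ is an odd prime and $e\ge1$, or $p=2$ and $e\le 2$, then for $1\le k\le e$ and $d\mid p-1$, $$f_{p,e}^{(k,d)}(\lambda)=\sum_{u=0}^{e-k-1}(k+u)\sum_{\substack{1\le t\le [n/(p^ud)]\\ (t,p)=1}}\lambda_{tp^ud}+e\sum_{t=1}^{[n/(p^{e-k}d)]}\lambda_{tp^{e-k}d}.$$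 If $p=2$ and $e\ge3$, then $$f_{2,e}^{(k,1)}(\lambda)=\sum_{u=0}^{e-k-1}(k+u)\sum_{\substack{1\le t\le[n/2^u]\\(t,2)=1}}\lambda_{t2^u}+e\sum_{t=1}^{[n/2^{e-k}]}\lambda_{t2^{e-k}}\quad(2\le k\le e),$$ $$f_{2,e}^{(k,2)}(\lambda)=\sum_{\substack{1\le t\le n\\(t,2)=1}}\lambda_t+\sum_{u=1}^{e-k-1}(k+u)\sum_{\substack{1\le t\le[n/2^u]\\(t,2)=1}}\lambda_{t2^u}+e\sum_{t=1}^{[n/2^{e-k}]}\lambda_{t2^{e-k}}\quad(2\le k\le e-1),$$ $$f_{2,e}^{(e,2)}(\lambda)=\sum_{\substack{1\le t\le n\\(t,2)=1}}\lambda_t+e\sum_{t=1}^{[n/2]}\lambda_{2t}.$$ *)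

theory Defs
  imports
    "HOL-Algebra.Product_Groups"
    "HOL-Algebra.Multiplicative_Group"
    "HOL-Number_Theory.Totient"
begin

(* Homomorphisms G -> F - {0}.  Extensionality makes a character determined by its values on
   the carrier of G, so that counting characters is meaningful. *)
definition characters :: "('a, 'b) monoid_scheme \<Rightarrow> ('f, 'c) ring_scheme \<Rightarrow> ('a \<Rightarrow> 'f) set" where
  "characters G F = hom G (mult_of F) \<inter> extensional (carrier G)"

definition ESC ::
  "('a, 'b) monoid_scheme \<Rightarrow> ('f, 'c) ring_scheme \<Rightarrow> 'i set \<Rightarrow> (('i \<Rightarrow> 'a) \<times> ('i \<Rightarrow> 'a \<Rightarrow> 'f)) set" where
  "ESC G F J = (J \<rightarrow>\<^sub>E carrier G) \<times> (J \<rightarrow>\<^sub>E characters G F)"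

definition ESC_isomorphic ::
  "('a, 'b) monoid_scheme \<Rightarrow> 'i set \<Rightarrow> ('i \<Rightarrow> 'a) \<times> ('i \<Rightarrow> 'a \<Rightarrow> 'f) \<Rightarrow>
   ('a2, 'b2) monoid_scheme \<Rightarrow> 'j set \<Rightarrow> ('j \<Rightarrow> 'a2) \<times> ('j \<Rightarrow> 'a2 \<Rightarrow> 'f) \<Rightarrow> bool" where
  "ESC_isomorphic G J x G' J' x' \<longleftrightarrow>
     (\<exists>\<phi> \<sigma>. \<phi> \<in> iso G G' \<and> bij_betw \<sigma> J J' \<and>
        (\<forall>i\<in>J. \<phi> (fst x i) = fst x' (\<sigma> i) \<and>
               (\<forall>a\<in>carrier G. snd x' (\<sigma> i) (\<phi> a) = snd x i a)))"

definition ESC_iso_rel ::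
  "('a, 'b) monoid_scheme \<Rightarrow> ('f, 'c) ring_scheme \<Rightarrow> 'i set \<Rightarrow>
   ((('i \<Rightarrow> 'a) \<times> ('i \<Rightarrow> 'a \<Rightarrow> 'f)) \<times> (('i \<Rightarrow> 'a) \<times> ('i \<Rightarrow> 'a \<Rightarrow> 'f))) set" where
  "ESC_iso_rel G F J = {(x, y). x \<in> ESC G F J \<and> y \<in> ESC G F J \<and> ESC_isomorphic G J x G J y}"

definition num_ESC :: "('a, 'b) monoid_scheme \<Rightarrow> ('f, 'c) ring_scheme \<Rightarrow> nat \<Rightarrow> nat" where
  "num_ESC G F n = card (ESC G F {1..n} // ESC_iso_rel G F {1..n})"

definition cycle_types :: "nat \<Rightarrow> (nat \<Rightarrow> nat) set" where
  "cycle_types n = {l \<in> {1..n} \<rightarrow>\<^sub>E (UNIV :: nat set). (\<Sum>t = 1..n. t * l t) = n}"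

(* fexp n p e k d l is the exponent f_{p,e}^{(k,d)}(l) for an n-tuple l.  It is meaningful for
   1 <= k <= e and d dvd p - 1 if p is odd or e <= 2, and for 2 <= k <= e and d in {1, 2} if
   p = 2 and e >= 3; for other arguments the value is irrelevant. *)
definition fexp :: "nat \<Rightarrow> nat \<Rightarrow> nat \<Rightarrow> nat \<Rightarrow> nat \<Rightarrow> (nat \<Rightarrow> nat) \<Rightarrow> nat" where
  "fexp n p e k d l =
     (if p = 2 \<and> 3 \<le> e then
        (if d = 1 then
           (\<Sum>u \<in> {0..<e - k}. (k + u) * (\<Sum>t | 1 \<le> t \<and> t \<le> n div 2 ^ u \<and> coprime t 2. l (t * 2 ^ u)))
           + e * (\<Sum>t = 1..n div 2 ^ (e - k). l (t * 2 ^ (e - k)))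
         else if k < e then
           (\<Sum>t | 1 \<le> t \<and> t \<le> n \<and> coprime t 2. l t)
           + (\<Sum>u \<in> {1..<e - k}. (k + u) * (\<Sum>t | 1 \<le> t \<and> t \<le> n div 2 ^ u \<and> coprime t 2. l (t * 2 ^ u)))
           + e * (\<Sum>t = 1..n div 2 ^ (e - k). l (t * 2 ^ (e - k)))
         else
           (\<Sum>t | 1 \<le> t \<and> t \<le> n \<and> coprime t 2. l t)
           + e * (\<Sum>t = 1..n div 2. l (2 * t)))
      else
        (\<Sum>u \<in> {0..<e - k}. (k + u) *
            (\<Sum>t | 1 \<le> t \<and> t \<le> n div (p ^ u * d) \<and> coprime t p. l (t * p ^ u * d)))
        + e * (\<Sum>t = 1..n div (p ^ (e - k) * d). l (t * p ^ (e - k) * d)))"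

end

theory Submission
  imports
    Defs
    "HOL-Algebra.Group_Action"
    "HOL-Algebra.Polynomial_Divisibility"
    "HOL-Combinatorics.Permutations"
    "HOL-Number_Theory.Residue_Primitive_Roots"
begin

text \<open>Up to reindexing, an element system with characters over \<open>G\<close> is a multiset of \<open>n\<close> pairs of an
  element and a character, so the isomorphism classes are the orbits of the automorphism group of
  \<open>G\<close> on these multisets, and Burnside's lemma reduces the count to multisets invariant under one
  automorphism \<open>f\<close>. Writing \<open>c t\<close> for the number of pairs fixed by the \<open>t\<close>-th iterate of \<open>f\<close>, the
  number \<open>M n\<close> of invariant multisets of size \<open>n\<close> satisfies the recursion
  \<open>n * M n = (\<Sum>t = 1..n. c t * M (n - t))\<close>, which is also the recursion of the cycle index of the
  symmetric group.

  For \<open>G\<close> cyclic of order \<open>m\<close> the automorphisms are the power maps by units \<open>x\<close> modulo \<open>m\<close>, and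
  \<open>c t = gcd (x ^ t - 1) m ^ 2\<close>. The resulting sum over units is multiplicative in \<open>m\<close> by the Chinese
  remainder theorem. Modulo a prime power with a primitive root \<open>g\<close>, the unit \<open>g ^ b\<close> contributes
  according to the gcd of \<open>b\<close> and the group order; modulo \<open>2 ^ e\<close> with \<open>e \<ge> 3\<close>, the units are
  \<open>1 + z\<close> and \<open>- (1 + z)\<close> with \<open>4 dvd z\<close>, and the contribution depends on the 2-adic valuation of \<open>z\<close>.\<close>

hide_const (open) Ring_Divisibility.mult_of Divisibility.prime

section \<open>Multisets invariant under a bijection\<close>

definition invariant_multisets :: "('a \<Rightarrow> 'a) \<Rightarrow> 'a set \<Rightarrow> nat \<Rightarrow> 'a multiset set" where
  "invariant_multisets h S n = {M \<in> multisets_of_size S n. image_mset h M = M}"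

text \<open>The length \<open>t\<close> is not tied to the period of \<open>y\<close>: a longer
  trajectory runs around the orbit repeatedly, and its points are counted each time they are
  visited.\<close>

primrec orbit_mset :: "('a \<Rightarrow> 'a) \<Rightarrow> nat \<Rightarrow> 'a \<Rightarrow> 'a multiset" where
  "orbit_mset h 0 y = {#}"
| "orbit_mset h (Suc t) y = add_mset ((h ^^ t) y) (orbit_mset h t y)"

lemma size_orbit_mset [simp]: "size (orbit_mset h t y) = t"
  by (induction t) auto

text \<open>A trajectory of length \<open>Suc t\<close> arises by prepending its first point to a
  shifted trajectory or by appending its last point.\<close>

lemma image_orbit_mset: "add_mset y (image_mset h (orbit_mset h t y)) = orbit_mset h (Suc t) y"
  by (induction t) (auto simp: add_mset_commute)

lemma set_orbit_mset: "set_mset (orbit_mset h t y) = (\<lambda>i. (h ^^ i) y) ` {..<t}"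
  by (induction t) (auto simp: lessThan_Suc)

lemma orbit_mset_invariant:
  assumes "(h ^^ t) y = y"
  shows "image_mset h (orbit_mset h t y) = orbit_mset h t y"
  using image_orbit_mset[of y h t] assms by simp

lemma count_orbit_mset: "count (orbit_mset h t y) z = card {i \<in> {..<t}. (h ^^ i) y = z}"
proof (induction t)
  case (Suc t)
  have "{i \<in> {..<Suc t}. (h ^^ i) y = z} =
    (if (h ^^ t) y = z then insert t {i \<in> {..<t}. (h ^^ i) y = z} else {i \<in> {..<t}. (h ^^ i) y = z})"
    by (auto simp: less_Suc_eq)
  with Suc show ?case by auto
qed auto

lemma bij_betw_funpow_period:
  assumes "finite S" "bij_betw h S S" "y \<in> S"
  obtains k where "k > 0" "(h ^^ k) y = y"
proof -
  have mem: "(h ^^ i) y \<in> S" for i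
    using bij_betw_funpow[OF assms(2), of i] assms(3) by (auto simp: bij_betw_def)
  have "\<not> inj_on (\<lambda>i. (h ^^ i) y) (UNIV :: nat set)"
    using assms(1) mem finite_subset[of "range (\<lambda>i. (h ^^ i) y)" S] finite_imageD[of "\<lambda>i. (h ^^ i) y" UNIV]
    by auto
  then obtain i j where "i \<noteq> j" "(h ^^ i) y = (h ^^ j) y" by (auto simp: inj_on_def)
  then obtain i j where ij: "i < j" "(h ^^ i) y = (h ^^ j) y"
    by (metis linorder_neqE_nat)
  have "(h ^^ i) y = (h ^^ i) ((h ^^ (j - i)) y)"
    using ij by (metis comp_apply funpow_add le_add_diff_inverse less_imp_le)
  moreover have "inj_on (h ^^ i) S" using bij_betw_funpow[OF assms(2)] by (auto simp: bij_betw_def)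
  ultimately have "(h ^^ (j - i)) y = y" using mem assms(3) by (auto dest: inj_onD)
  thus thesis using ij by (intro that[of "j - i"]) auto
qed

text \<open>A trajectory whose length is \<open>j\<close> times the minimal period of
  \<open>y\<close> meets \<open>y\<close> once per round; finiteness of \<open>S\<close> provides
  the period.\<close>

lemma ex_orbit_mset_count:
  assumes "finite S" "bij_betw h S S" "y \<in> S"
  obtains t where "(h ^^ t) y = y" "count (orbit_mset h t y) y = j"
proof -
  define k where "k = (LEAST k. k > 0 \<and> (h ^^ k) y = y)"
  have k: "k > 0 \<and> (h ^^ k) y = y"
    unfolding k_def by (rule LeastI_ex) (use bij_betw_funpow_period[OF assms] in blast)
  have fix_iff: "(h ^^ i) y = y \<longleftrightarrow> k dvd i" for i
  proof
    assume "(h ^^ i) y = y"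
    hence "(h ^^ (i mod k)) y = y" using funpow_mod_eq[OF conjunct2[OF k]] by metis
    hence "\<not> i mod k > 0" using not_less_Least[of "i mod k" "\<lambda>k. k > 0 \<and> (h ^^ k) y = y"] k
      unfolding k_def[symmetric] by (meson mod_less_divisor)
    thus "k dvd i" by (simp add: dvd_eq_mod_eq_0)
  next
    assume "k dvd i"
    thus "(h ^^ i) y = y"
      using funpow_mod_eq[OF conjunct2[OF k], of i] by (simp add: dvd_eq_mod_eq_0)
  qed
  have "{i \<in> {..<k * j}. (h ^^ i) y = y} = (\<lambda>i. k * i) ` {..<j}"
    using k by (auto simp: fix_iff elim!: dvdE)
  moreover have "inj_on (\<lambda>i. k * i) {..<j}" using k by (auto simp: inj_on_def)
  ultimately have "count (orbit_mset h (k * j) y) y = j"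
    by (simp add: count_orbit_mset card_image)
  with fix_iff[of "k * j"] show thesis by (intro that[of "k * j"]) auto
qed

text \<open>Since \<open>h\<close> is injective on \<open>S\<close>, the only element of
  \<open>M\<close> that \<open>h\<close> can send to \<open>h w\<close> is \<open>w\<close>, so each
  application of \<open>h\<close> preserves the multiplicity.\<close>

lemma count_invariant:
  assumes "bij_betw h S S" "set_mset M \<subseteq> S" "image_mset h M = M" "z \<in> S"
  shows "count M ((h ^^ i) z) = count M z"
proof (induction i)
  case (Suc i)
  let ?w = "(h ^^ i) z"
  have w: "?w \<in> S" using bij_betw_funpow[OF assms(1), of i] assms(4) by (auto simp: bij_betw_def)
  have "count M (h ?w) = count (image_mset h M) (h ?w)" using assms(3) by simp
  also have "\<dots> = (\<Sum>x | x \<in># M \<and> h ?w = h x. count M x)" by (rule count_image_mset')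
  also have "{x. x \<in># M \<and> h ?w = h x} = (if ?w \<in># M then {?w} else {})"
    using w assms(1,2) by (auto simp: bij_betw_def dest: inj_onD)
  also have "(\<Sum>x \<in> \<dots>. count M x) = count M ?w" by (auto simp: not_in_iff)
  finally show ?case using Suc by simp
qed simp

text \<open>The inverse removes from \<open>M\<close> the trajectory that visits \<open>y\<close>
  exactly \<open>j\<close> times. It fits into \<open>M\<close> because invariant multisets have
  constant multiplicity along an orbit, and its length is recovered from \<open>j\<close> because
  the number of visits grows strictly beyond each return time.\<close>

lemma bij_betw_add_orbit_mset:
  assumes S: "finite S" "bij_betw h S S" and y: "y \<in> S"
  shows "bij_betw (\<lambda>(t, M). (M + orbit_mset h t y, count (orbit_mset h t y) y))
     (SIGMA t:{t \<in> {1..n}. (h ^^ t) y = y}. invariant_multisets h S (n - t))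
     (SIGMA M:invariant_multisets h S n. {1..count M y})"
    (is "bij_betw ?f ?A ?B")
proof (rule bij_betwI')
  have set_orb: "set_mset (orbit_mset h t y) \<subseteq> S" for t
    using bij_betw_funpow[OF S(2)] y by (auto simp: set_orbit_mset bij_betw_def)
  \<comment> \<open>Time \<open>t\<close> is itself a visit, counted for \<open>t'\<close> but not
    for \<open>t\<close>.\<close>
  have less: "count (orbit_mset h t y) y < count (orbit_mset h t' y) y"
    if "t < t'" "(h ^^ t) y = y" for t t'
    unfolding count_orbit_mset using that by (intro psubset_card_mono) auto
  show "?f a = ?f b \<longleftrightarrow> a = b" if "a \<in> ?A" "b \<in> ?A" for a b
  proof
    assume "?f a = ?f b"
    moreover obtain t M t' M' where ab: "a = (t, M)" "b = (t', M')" by (cases a, cases b)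
    ultimately have "t = t'" using that less[of t t'] less[of t' t]
      by (cases t t' rule: linorder_cases) auto
    with ab \<open>?f a = ?f b\<close> show "a = b" by simp
  qed auto
  show "?f a \<in> ?B" if "a \<in> ?A" for a
  proof -
    obtain t M where a: "a = (t, M)" by (cases a)
    \<comment> \<open>The start of a nonempty trajectory is a visit, so the recorded count is at
      least 1.\<close>
    have "0 \<in> {i \<in> {..<t}. (h ^^ i) y = y}" using that a by auto
    hence "card {i \<in> {..<t}. (h ^^ i) y = y} > 0" by (subst card_gt_0_iff) auto
    with a that set_orb[of t] show ?thesis
      by (auto simp: invariant_multisets_def multisets_of_size_def orbit_mset_invariant count_orbit_mset)
  qed
  show "\<exists>a \<in> ?A. b = ?f a" if "b \<in> ?B" for b
  proof -
    obtain M j where b: "b = (M, j)" by (cases b)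
    with that have M: "set_mset M \<subseteq> S" "size M = n" "image_mset h M = M" and j: "1 \<le> j" "j \<le> count M y"
      by (auto simp: invariant_multisets_def multisets_of_size_def)
    obtain t where t: "(h ^^ t) y = y" "count (orbit_mset h t y) y = j"
      using ex_orbit_mset_count[OF S y] .
    have "t \<noteq> 0" using t(2) j by (cases t) auto
    \<comment> \<open>Both multisets are invariant, so the comparison at any trajectory point
      reduces to the one at \<open>y\<close>, which is \<open>j \<le> count M y\<close>.\<close>
    have sub: "orbit_mset h t y \<subseteq># M"
    proof (rule mset_subset_eqI)
      fix z
      show "count (orbit_mset h t y) z \<le> count M z"
      proof (cases "z \<in># orbit_mset h t y")
        case True
        then obtain i where z: "z = (h ^^ i) y" by (auto simp: set_orbit_mset)
        have "count (orbit_mset h t y) z = j"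
          using z t count_invariant[OF S(2) set_orb orbit_mset_invariant y] by metis
        moreover have "count M z = count M y"
          using z M count_invariant[OF S(2) _ _ y] by metis
        ultimately show ?thesis using j by simp
      qed (simp add: not_in_iff)
    qed
    have "image_mset h (M - orbit_mset h t y) = M - orbit_mset h t y"
      using sub t M by (simp add: image_mset_Diff orbit_mset_invariant)
    moreover have "t \<le> n" using size_mset_mono[OF sub] M by simp
    ultimately have "(t, M - orbit_mset h t y) \<in> ?A"
      using t M \<open>t \<noteq> 0\<close> size_Diff_submset[OF sub]
      by (auto simp: invariant_multisets_def multisets_of_size_def dest: in_diffD)
    moreover have "b = ?f (t, M - orbit_mset h t y)" using b t sub by simp
    ultimately show ?thesis by blast
  qed
qed

lemma finite_invariant_multisets [simp]:
  "finite S \<Longrightarrow> finite (invariant_multisets h S n)"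
  unfolding invariant_multisets_def by (rule finite_subset[OF _ finite_multisets_of_size]) blast+

text \<open>Both sides count the triples \<open>(M, y, j)\<close> with \<open>M\<close> invariant and \<open>1 \<le> j \<le> count M y\<close>: such a
  triple is determined by removing from \<open>M\<close> the part of the trajectory of \<open>y\<close> that visits \<open>y\<close>
  exactly \<open>j\<close> times.\<close>

lemma card_invariant_multisets_rec:
  assumes "finite S" "bij_betw h S S"
  shows "n * card (invariant_multisets h S n) =
    (\<Sum>t = 1..n. card {y \<in> S. (h ^^ t) y = y} * card (invariant_multisets h S (n - t)))"
proof -
  note [simp] = assms(1)
  let ?I = "invariant_multisets h S"
  have "n * card (?I n) = (\<Sum>M \<in> ?I n. size M)"
    by (simp add: invariant_multisets_def multisets_of_size_def)
  also have "\<dots> = (\<Sum>M \<in> ?I n. \<Sum>y \<in> S. count M y)"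
    by (intro sum.cong refl)
      (auto simp: invariant_multisets_def multisets_of_size_def size_multiset_overloaded_eq
        not_in_iff intro!: sum.mono_neutral_left)
  also have "\<dots> = (\<Sum>y \<in> S. \<Sum>M \<in> ?I n. count M y)" by (rule sum.swap)
  also have "\<dots> = (\<Sum>y \<in> S. card (SIGMA M:?I n. {1..count M y}))" by simp
  also have "\<dots> = (\<Sum>y \<in> S. card (SIGMA t:{t \<in> {1..n}. (h ^^ t) y = y}. ?I (n - t)))"
    using bij_betw_same_card[OF bij_betw_add_orbit_mset[OF assms]] by (intro sum.cong) auto
  also have "\<dots> = (\<Sum>y \<in> S. \<Sum>t = 1..n. if (h ^^ t) y = y then card (?I (n - t)) else 0)"
    by (intro sum.cong refl, subst card_SigmaI) (simp_all only: sum.inter_filter finite_atLeastAtMost, auto)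
  also have "\<dots> = (\<Sum>t = 1..n. \<Sum>y \<in> S. if (h ^^ t) y = y then card (?I (n - t)) else 0)"
    by (rule sum.swap)
  also have "\<dots> = (\<Sum>t = 1..n. card {y \<in> S. (h ^^ t) y = y} * card (?I (n - t)))"
    by (simp flip: sum.inter_filter)
  finally show ?thesis .
qed

section \<open>Weighted partitions and the recursion of the cycle index\<close>

text \<open>The set \<open>cycle_types n\<close> is \<open>weighted_partitions n n\<close>; separating the number \<open>N\<close> of parts from
  the weight \<open>k\<close> lets the recursion lower the weight without changing the index set.\<close>

definition weighted_partitions :: "nat \<Rightarrow> nat \<Rightarrow> (nat \<Rightarrow> nat) set" where
  "weighted_partitions N k = {l \<in> {1..N} \<rightarrow>\<^sub>E UNIV. (\<Sum>t = 1..N. t * l t) = k}"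

lemma weighted_partitions_le:
  assumes "l \<in> weighted_partitions N k" "t \<in> {1..N}"
  shows "t * l t \<le> k"
  using assms member_le_sum[of t "{1..N}" "\<lambda>t. t * l t"] by (auto simp: weighted_partitions_def)

lemma finite_weighted_partitions [simp]: "finite (weighted_partitions N k)"
proof (rule finite_subset)
  show "weighted_partitions N k \<subseteq> {1..N} \<rightarrow>\<^sub>E {..k}"
  proof
    fix l assume l: "l \<in> weighted_partitions N k"
    have "l t \<le> k" if "t \<in> {1..N}" for t
    proof -
      have "1 * l t \<le> t * l t" using that by (intro mult_le_mono1) simp
      with weighted_partitions_le[OF l that] show ?thesis by linarith
    qed
    with l show "l \<in> {1..N} \<rightarrow>\<^sub>E {..k}" by (auto simp: weighted_partitions_def PiE_iff)
  qed
qed (intro finite_PiE; simp)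

text \<open>Adding one part of size \<open>t\<close> is undone by removing one.\<close>

lemma bij_betw_weighted_partitions:
  assumes "t \<in> {1..N}" "t \<le> k"
  shows "bij_betw (\<lambda>l. l(t := Suc (l t))) (weighted_partitions N (k - t))
           {l \<in> weighted_partitions N k. l t > 0}"
proof (rule bij_betw_byWitness[where f' = "\<lambda>l. l(t := l t - 1)"])
  \<comment> \<open>Stated with sums on both sides to avoid truncated subtraction.\<close>
  have upd: "(\<Sum>i = 1..N. i * (l(t := a)) i) + t * l t = (\<Sum>i = 1..N. i * l i) + t * a" for l a
  proof -
    have "(\<Sum>i = 1..N. i * (l(t := a)) i) = t * a + (\<Sum>i \<in> {1..N} - {t}. i * l i)"
      using assms(1) by (subst sum.remove[of _ t]) auto
    moreover have "(\<Sum>i = 1..N. i * l i) = t * l t + (\<Sum>i \<in> {1..N} - {t}. i * l i)"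
      using assms(1) by (subst sum.remove[of _ t]) auto
    ultimately show ?thesis by simp
  qed
  show "(\<lambda>l. l(t := Suc (l t))) ` weighted_partitions N (k - t) \<subseteq> {l \<in> weighted_partitions N k. l t > 0}"
  proof safe
    fix l assume "l \<in> weighted_partitions N (k - t)"
    with upd[of l "Suc (l t)"] assms show "l(t := Suc (l t)) \<in> weighted_partitions N k"
      by (auto simp: weighted_partitions_def PiE_iff extensional_def)
  qed auto
  show "(\<lambda>l. l(t := l t - 1)) ` {l \<in> weighted_partitions N k. l t > 0} \<subseteq> weighted_partitions N (k - t)"
  proof safe
    fix l assume l: "l \<in> weighted_partitions N k" "0 < l t"
    then obtain a where "l t = Suc a" by (cases "l t") auto
    with upd[of l "l t - 1"] assms l show "l(t := l t - 1) \<in> weighted_partitions N (k - t)"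
      by (auto simp: weighted_partitions_def PiE_iff extensional_def)
  qed
qed auto

text \<open>In each term \<open>k\<close> is expanded as the sum of the \<open>t * l t\<close>, and
  one part of size \<open>t\<close> is removed: the factor \<open>t * l t\<close> cancels the change
  in the denominator of the weight. Here \<open>w\<close> is a term of the cycle index of the
  symmetric group, with \<open>c t\<close> put for the \<open>t\<close>-th variable.\<close>

lemma weighted_partitions_sum_rec:
  fixes c :: "nat \<Rightarrow> real"
  assumes "k \<le> N"
  defines "w \<equiv> \<lambda>l. \<Prod>t = 1..N. c t ^ l t / (fact (l t) * real t ^ l t)"
  shows "real k * (\<Sum>l \<in> weighted_partitions N k. w l) =
           (\<Sum>t = 1..k. c t * (\<Sum>l \<in> weighted_partitions N (k - t). w l))"
proof -
  let ?P = "weighted_partitions N"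
  have w_upd: "real (t * Suc (l t)) * w (l(t := Suc (l t))) = c t * w l" if "t \<in> {1..N}" for l t
  proof -
    let ?r = "\<Prod>i \<in> {1..N} - {t}. c i ^ l i / (fact (l i) * real i ^ l i)"
    have w1: "w (l(t := Suc (l t))) = c t ^ Suc (l t) / (fact (Suc (l t)) * real t ^ Suc (l t)) * ?r"
      unfolding w_def using that by (subst prod.remove[of _ t]) auto
    have w2: "w l = c t ^ l t / (fact (l t) * real t ^ l t) * ?r"
      unfolding w_def using that by (subst prod.remove[of _ t]) auto
    have cancel: "a * b * (z * x / (b * f * (a * r))) = z * (x / (f * r))"
      if "a \<noteq> 0" "b \<noteq> 0" for a b f r x z :: real
      using that by simp
    have w3: "real (t * Suc (l t)) * (c t ^ Suc (l t) / (fact (Suc (l t)) * real t ^ Suc (l t)))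
        = c t * (c t ^ l t / (fact (l t) * real t ^ l t))"
      unfolding fact_Suc power_Suc of_nat_mult by (rule cancel) (use that in auto)
    show ?thesis unfolding w1 w2 mult.assoc [symmetric] w3 ..
  qed
  have part: "(\<Sum>l \<in> ?P k. real (t * l t) * w l) = c t * (\<Sum>l \<in> ?P (k - t). w l)"
    if t: "t \<in> {1..N}" "t \<le> k" for t
  proof -
    have "(\<Sum>l \<in> ?P k. real (t * l t) * w l) = (\<Sum>l \<in> {l \<in> ?P k. l t > 0}. real (t * l t) * w l)"
      by (intro sum.mono_neutral_right) auto
    also have "\<dots> = (\<Sum>l \<in> ?P (k - t). real (t * Suc (l t)) * w (l(t := Suc (l t))))"
      using sum.reindex_bij_betw[OF bij_betw_weighted_partitions[OF t], of "\<lambda>l. real (t * l t) * w l"]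
      by simp
    also have "\<dots> = c t * (\<Sum>l \<in> ?P (k - t). w l)"
      unfolding w_upd[OF t(1)] by (simp add: sum_distrib_left)
    finally show ?thesis .
  qed
  have "real k * (\<Sum>l \<in> ?P k. w l) = (\<Sum>l \<in> ?P k. real (\<Sum>t = 1..N. t * l t) * w l)"
    unfolding sum_distrib_left by (intro sum.cong) (auto simp: weighted_partitions_def)
  also have "\<dots> = (\<Sum>l \<in> ?P k. \<Sum>t = 1..N. real (t * l t) * w l)"
    by (simp add: sum_distrib_right)
  also have "\<dots> = (\<Sum>t = 1..N. \<Sum>l \<in> ?P k. real (t * l t) * w l)" by (rule sum.swap)
  \<comment> \<open>A partition of \<open>k\<close> has no part larger than
    \<open>k\<close>.\<close>
  also have "\<dots> = (\<Sum>t = 1..k. \<Sum>l \<in> ?P k. real (t * l t) * w l)"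
  proof (rule sum.mono_neutral_right)
    show "\<forall>t \<in> {1..N} - {1..k}. (\<Sum>l \<in> ?P k. real (t * l t) * w l) = 0"
    proof
      fix t assume t: "t \<in> {1..N} - {1..k}"
      have "l t = 0" if "l \<in> ?P k" for l
        using weighted_partitions_le[OF that, of t] t by (cases "l t") auto
      thus "(\<Sum>l \<in> ?P k. real (t * l t) * w l) = 0" by (intro sum.neutral) simp
    qed
  qed (use assms(1) in auto)
  also have "\<dots> = (\<Sum>t = 1..k. c t * (\<Sum>l \<in> ?P (k - t). w l))"
    using assms(1) by (intro sum.cong part) auto
  finally show ?thesis .
qed

text \<open>Both sides equal 1 for \<open>n = 0\<close> and satisfy the same recursion.
  \<open>N\<close> stays fixed during the induction, so that the weights do not change with
  \<open>n\<close>.\<close>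

lemma card_invariant_multisets_weighted:
  assumes "finite S" "bij_betw h S S" "n \<le> N"
  shows "real (card (invariant_multisets h S n)) =
    (\<Sum>l \<in> weighted_partitions N n.
       \<Prod>t = 1..N. real (card {y \<in> S. (h ^^ t) y = y}) ^ l t / (fact (l t) * real t ^ l t))"
  using assms(3)
proof (induction n rule: less_induct)
  case (less n)
  show ?case
  proof (cases "n = 0")
    case True
    have "invariant_multisets h S 0 = {{#}}" by (auto simp: invariant_multisets_def)
    moreover have "weighted_partitions N 0 = {restrict (\<lambda>_. 0) {1..N}}"
      by (auto simp: weighted_partitions_def fun_eq_iff PiE_iff extensional_def)
    ultimately show ?thesis using True by simp
  next
    case False
    let ?c = "\<lambda>t. real (card {y \<in> S. (h ^^ t) y = y})"
    let ?w = "\<lambda>l. \<Prod>t = 1..N. ?c t ^ l t / (fact (l t) * real t ^ l t)"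
    have "real n * real (card (invariant_multisets h S n)) =
        (\<Sum>t = 1..n. ?c t * real (card (invariant_multisets h S (n - t))))"
      using arg_cong[OF card_invariant_multisets_rec[OF assms(1,2), of n], of real] by simp
    also have "\<dots> = (\<Sum>t = 1..n. ?c t * (\<Sum>l \<in> weighted_partitions N (n - t). ?w l))"
      using less by (intro sum.cong refl) simp
    also have "\<dots> = real n * (\<Sum>l \<in> weighted_partitions N n. ?w l)"
      using weighted_partitions_sum_rec[OF less.prems, of ?c] by simp
    finally show ?thesis using False by simp
  qed
qed

section \<open>Isomorphism classes as orbits of the automorphism group\<close>

text \<open>Each \<open>act g\<close> is bijective because \<open>act (inv g)\<close> undoes it. The
  restriction to \<open>E\<close> is there because \<open>BijGroup E\<close> consists of extensional
  functions.\<close>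

lemma (in group) group_actionI:
  assumes closed: "\<And>g x. g \<in> carrier G \<Longrightarrow> x \<in> E \<Longrightarrow> act g x \<in> E"
    and one: "\<And>x. x \<in> E \<Longrightarrow> act \<one> x = x"
    and mult: "\<And>g h x. g \<in> carrier G \<Longrightarrow> h \<in> carrier G \<Longrightarrow> x \<in> E \<Longrightarrow> act (g \<otimes> h) x = act g (act h x)"
  shows "group_action G E (\<lambda>g. \<lambda>x \<in> E. act g x)"
proof -
  have bij: "(\<lambda>x \<in> E. act g x) \<in> Bij E" if g: "g \<in> carrier G" for g
  proof -
    have inv: "act (inv g) (act g x) = x" "act g (act (inv g) x) = x" if "x \<in> E" for x
      using mult[of "inv g" g x] mult[of g "inv g" x] one[OF that] g that by simp_all
    have "bij_betw (\<lambda>x \<in> E. act g x) E E"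
      by (rule bij_betw_byWitness[where f' = "act (inv g)"]) (use inv closed g in auto)
    thus ?thesis by (simp add: Bij_def)
  qed
  show ?thesis
    unfolding group_action_def
  proof (rule group_hom.intro[OF is_group group_BijGroup], unfold_locales, rule homI)
    fix g h assume gh: "g \<in> carrier G" "h \<in> carrier G"
    thus "(\<lambda>x \<in> E. act (g \<otimes> h) x) = (\<lambda>x \<in> E. act g x) \<otimes>\<^bsub>BijGroup E\<^esub> (\<lambda>x \<in> E. act h x)"
      using bij by (auto simp: BijGroup_def compose_def fun_eq_iff mult closed)
  qed (use bij in \<open>simp add: BijGroup_def\<close>)
qed

context group_action
begin

lemma image_mset_multisets_of_size:
  assumes "g \<in> carrier G" "M \<in> multisets_of_size E n"
  shows "image_mset (\<phi> g) M \<in> multisets_of_size E n"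
  using assms surj_prop[of g] by (auto simp: multisets_of_size_def)

lemma group_action_multisets:
  "group_action G (multisets_of_size E n) (\<lambda>g. \<lambda>M \<in> multisets_of_size E n. image_mset (\<phi> g) M)"
proof -
  interpret G: group G using group_hom group_hom.axioms(1) by auto
  show ?thesis
  proof (rule G.group_actionI)
    fix M assume M: "M \<in> multisets_of_size E n"
    show "image_mset (\<phi> \<one>) M = M"
    proof -
      have "image_mset (\<phi> \<one>) M = image_mset (\<lambda>x. x) M"
        using M by (intro image_mset_cong) (auto simp: multisets_of_size_def id_eq_one[symmetric])
      thus ?thesis by simp
    qed
    fix g h assume gh: "g \<in> carrier G" "h \<in> carrier G"
    show "image_mset (\<phi> (g \<otimes> h)) M = image_mset (\<phi> g) (image_mset (\<phi> h) M)"
      using M gh composition_rule by (auto simp: multisets_of_size_def image_mset.compositionality intro!: image_mset_cong)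
  qed (rule image_mset_multisets_of_size)
qed

lemma funpow_eq_action_pow:
  assumes "g \<in> carrier G" "x \<in> E"
  shows "(\<phi> g ^^ t) x = \<phi> (g [^] t) x"
proof (induction t)
  case 0
  show ?case using assms(2) by (simp add: id_eq_one[symmetric])
next
  case (Suc t)
  interpret G: group G using group_hom group_hom.axioms(1) by auto
  have "\<phi> (g [^] Suc t) x = \<phi> (g \<otimes> g [^] t) x" using assms G.nat_pow_Suc2 by simp
  thus ?case using Suc assms by (simp add: composition_rule)
qed

text \<open>Burnside's lemma sums, over \<open>g\<close>, the numbers of multisets fixed by
  \<open>g\<close>; these are the invariant multisets of the bijection \<open>\<phi> g\<close>, and
  the iterates of \<open>\<phi> g\<close> are the actions of the powers of \<open>g\<close>.\<close>

lemma card_orbits_multisets: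
  assumes "finite (carrier G)" "finite E"
  shows "real (card (orbits G (multisets_of_size E n) (\<lambda>g. \<lambda>M \<in> multisets_of_size E n. image_mset (\<phi> g) M)))
      * real (order G) =
    (\<Sum>l \<in> weighted_partitions n n. \<Sum>g \<in> carrier G.
       \<Prod>t = 1..n. real (card {x \<in> E. \<phi> (g [^] t) x = x}) ^ l t / (fact (l t) * real t ^ l t))"
proof -
  let ?X = "multisets_of_size E n"
  interpret M: group_action G ?X "\<lambda>g. \<lambda>M \<in> ?X. image_mset (\<phi> g) M"
    by (rule group_action_multisets)
  have "real (card (orbits G ?X (\<lambda>g. \<lambda>M \<in> ?X. image_mset (\<phi> g) M))) * real (order G)
      = (\<Sum>g \<in> carrier G. real (card (invariants ?X (\<lambda>g. \<lambda>M \<in> ?X. image_mset (\<phi> g) M) g)))"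
    using M.burnside[OF assms(1) finite_multisets_of_size[OF assms(2)]]
    by (simp flip: of_nat_mult of_nat_sum)
  also have "\<dots> = (\<Sum>g \<in> carrier G. real (card (invariant_multisets (\<phi> g) E n)))"
    by (intro sum.cong refl arg_cong[where f = real] arg_cong[where f = card])
      (auto simp: invariants_def invariant_multisets_def)
  also have "\<dots> = (\<Sum>g \<in> carrier G. \<Sum>l \<in> weighted_partitions n n.
      \<Prod>t = 1..n. real (card {x \<in> E. (\<phi> g ^^ t) x = x}) ^ l t / (fact (l t) * real t ^ l t))"
    by (intro sum.cong refl card_invariant_multisets_weighted)
      (use assms inj_prop surj_prop in \<open>auto simp: bij_betw_def\<close>)
  also have "\<dots> = (\<Sum>g \<in> carrier G. \<Sum>l \<in> weighted_partitions n n.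
      \<Prod>t = 1..n. real (card {x \<in> E. \<phi> (g [^] t) x = x}) ^ l t / (fact (l t) * real t ^ l t))"
    by (intro sum.cong prod.cong refl arg_cong2[where f = "(/)"] arg_cong2[where f = "(^)"]
        arg_cong[where f = real] arg_cong[where f = card])
      (auto simp: funpow_eq_action_pow)
  finally show ?thesis by (subst sum.swap)
qed

end

text \<open>The classes are the nonempty fibres of \<open>f\<close>.\<close>

lemma card_quotient_kernel:
  "card (A // {(x, y). x \<in> A \<and> y \<in> A \<and> f x = f y}) = card (f ` A)"
proof -
  let ?r = "{(x, y). x \<in> A \<and> y \<in> A \<and> f x = f y}"
  have "bij_betw (\<lambda>b. {x \<in> A. f x = b}) (f ` A) (A // ?r)"
  proof (rule bij_betwI')
    show "\<exists>b \<in> f ` A. C = {x \<in> A. f x = b}" if C: "C \<in> A // ?r" for C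
    proof -
      obtain x where x: "x \<in> A" "C = ?r `` {x}" using C unfolding quotient_def by blast
      hence "C = {y \<in> A. f y = f x}" by auto
      with x show ?thesis by (intro bexI[of _ "f x"]) simp_all
    qed
    show "{x \<in> A. f x = b} \<in> A // ?r" if "b \<in> f ` A" for b
      using that by (auto simp: quotient_def Image_def)
  qed auto
  thus ?thesis by (simp add: bij_betw_same_card)
qed

section \<open>The automorphism group acting on pairs of an element and a character\<close>

context group
begin

lemma AutoGroup_simps:
  "carrier (AutoGroup G) = auto G"
  "\<one>\<^bsub>AutoGroup G\<^esub> = (\<lambda>x \<in> carrier G. x)"
  "f \<in> auto G \<Longrightarrow> g \<in> auto G \<Longrightarrow> f \<otimes>\<^bsub>AutoGroup G\<^esub> g = compose (carrier G) f g"
  by (auto simp: AutoGroup_def BijGroup_def auto_def)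

lemma auto_closed: "f \<in> auto G \<Longrightarrow> x \<in> carrier G \<Longrightarrow> f x \<in> carrier G"
  by (auto simp: auto_def hom_def)

lemma auto_inv:
  assumes "f \<in> auto G"
  shows "inv\<^bsub>AutoGroup G\<^esub> f \<in> auto G"
    and "x \<in> carrier G \<Longrightarrow> f ((inv\<^bsub>AutoGroup G\<^esub> f) x) = x"
    and "x \<in> carrier G \<Longrightarrow> (inv\<^bsub>AutoGroup G\<^esub> f) (f x) = x"
proof -
  interpret A: group "AutoGroup G" by (rule AutoGroup)
  show inv: "inv\<^bsub>AutoGroup G\<^esub> f \<in> auto G"
    using A.inv_closed[of f] assms by (simp add: AutoGroup_simps)
  have "compose (carrier G) f (inv\<^bsub>AutoGroup G\<^esub> f) = (\<lambda>x \<in> carrier G. x)"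
    using A.r_inv[of f] assms inv by (simp add: AutoGroup_simps)
  from fun_cong[OF this, of x] show "x \<in> carrier G \<Longrightarrow> f ((inv\<^bsub>AutoGroup G\<^esub> f) x) = x"
    by (simp add: compose_def)
  have "compose (carrier G) (inv\<^bsub>AutoGroup G\<^esub> f) f = (\<lambda>x \<in> carrier G. x)"
    using A.l_inv[of f] assms inv by (simp add: AutoGroup_simps)
  from fun_cong[OF this, of x] show "x \<in> carrier G \<Longrightarrow> (inv\<^bsub>AutoGroup G\<^esub> f) (f x) = x"
    by (simp add: compose_def)
qed

lemma compose_character:
  assumes "\<chi> \<in> characters G F" "f \<in> auto G"
  shows "compose (carrier G) \<chi> f \<in> characters G F"
  using assms hom_compose[of f G \<chi> "mult_of F"] by (auto simp: characters_def auto_def)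

text \<open>Composing characters with the inverse makes this a left action and matches the
  compatibility of characters in \<open>ESC_isomorphic\<close>.\<close>

definition auto_action :: "('f, 'c) ring_scheme \<Rightarrow> ('a \<Rightarrow> 'a) \<Rightarrow> 'a \<times> ('a \<Rightarrow> 'f) \<Rightarrow> 'a \<times> ('a \<Rightarrow> 'f)" where
  "auto_action F f = (\<lambda>p \<in> carrier G \<times> characters G F.
     (f (fst p), compose (carrier G) (snd p) (inv\<^bsub>AutoGroup G\<^esub> f)))"

lemma group_action_auto: "group_action (AutoGroup G) (carrier G \<times> characters G F) (auto_action F)"
proof -
  interpret A: group "AutoGroup G" by (rule AutoGroup)
  show ?thesis
    unfolding auto_action_def
  proof (rule A.group_actionI)
    show "(f (fst p), compose (carrier G) (snd p) (inv\<^bsub>AutoGroup G\<^esub> f)) \<in> carrier G \<times> characters G F"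
      if "f \<in> carrier (AutoGroup G)" "p \<in> carrier G \<times> characters G F" for f p
      using that by (auto simp: AutoGroup_simps auto_closed compose_character auto_inv)
  next
    fix p assume "p \<in> carrier G \<times> characters G F"
    thus "(\<one>\<^bsub>AutoGroup G\<^esub> (fst p), compose (carrier G) (snd p) (inv\<^bsub>AutoGroup G\<^esub> \<one>\<^bsub>AutoGroup G\<^esub>)) = p"
      by (auto simp: A.inv_one [unfolded AutoGroup_simps(2)] AutoGroup_simps(2) characters_def hom_def)
  next
    fix f g p
    assume "f \<in> carrier (AutoGroup G)" "g \<in> carrier (AutoGroup G)" and p: "p \<in> carrier G \<times> characters G F"
    hence fg: "f \<in> auto G" "g \<in> auto G" by (simp_all add: AutoGroup_simps)
    have "inv\<^bsub>AutoGroup G\<^esub> (f \<otimes>\<^bsub>AutoGroup G\<^esub> g)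
        = compose (carrier G) (inv\<^bsub>AutoGroup G\<^esub> g) (inv\<^bsub>AutoGroup G\<^esub> f)"
      using A.inv_mult_group[of f g] fg by (simp add: AutoGroup_simps auto_inv)
    moreover have "inv\<^bsub>AutoGroup G\<^esub> f \<in> carrier G \<rightarrow> carrier G"
      using auto_inv(1)[OF fg(1)] auto_closed by auto
    ultimately show "((f \<otimes>\<^bsub>AutoGroup G\<^esub> g) (fst p),
          compose (carrier G) (snd p) (inv\<^bsub>AutoGroup G\<^esub> (f \<otimes>\<^bsub>AutoGroup G\<^esub> g))) =
        (f (fst (g (fst p), compose (carrier G) (snd p) (inv\<^bsub>AutoGroup G\<^esub> g))),
          compose (carrier G) (snd (g (fst p), compose (carrier G) (snd p) (inv\<^bsub>AutoGroup G\<^esub> g)))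
            (inv\<^bsub>AutoGroup G\<^esub> f))"
      using p fg by (auto simp: compose_assoc AutoGroup_simps compose_eq)
  qed
qed

text \<open>A character is invariant under an automorphism exactly when it is invariant under the
  inverse. The product form lets elements and characters be counted separately.\<close>

lemma auto_action_fixed_points:
  assumes "f \<in> auto G"
  shows "{p \<in> carrier G \<times> characters G F. auto_action F f p = p} =
     {x \<in> carrier G. f x = x} \<times> {\<chi> \<in> characters G F. compose (carrier G) \<chi> f = \<chi>}"
proof -
  have "compose (carrier G) \<chi> (inv\<^bsub>AutoGroup G\<^esub> f) = \<chi> \<longleftrightarrow> compose (carrier G) \<chi> f = \<chi>"
    if "\<chi> \<in> characters G F" for \<chi>
  proof -
    have *: "compose (carrier G) \<chi> g = \<chi> \<longleftrightarrow> (\<forall>x \<in> carrier G. \<chi> (g x) = \<chi> x)" for g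
      using that by (auto simp: characters_def compose_def fun_eq_iff extensional_def)
    show ?thesis
      unfolding * using auto_inv[OF assms] auto_closed[OF assms] auto_closed[OF auto_inv(1)[OF assms]] by metis
  qed
  thus ?thesis by (auto simp: auto_action_def)
qed

text \<open>Two families over a finite index set have the same multiset of values exactly when a
  permutation of the indices takes one to the other. Passing to multisets thus absorbs the index
  bijection and leaves the automorphism.\<close>

lemma ESC_isomorphic_iff_multiset:
  fixes J :: "'i set" and x y :: "('i \<Rightarrow> 'a) \<times> ('i \<Rightarrow> 'a \<Rightarrow> 'f)"
  defines "ms \<equiv> \<lambda>x. image_mset (\<lambda>i. (fst x i, snd x i)) (mset_set J)"
  assumes J: "finite J" and x: "x \<in> ESC G F J" and y: "y \<in> ESC G F J"
  shows "ESC_isomorphic G J x G J y \<longleftrightarrow> (\<exists>f \<in> auto G. image_mset (auto_action F f) (ms x) = ms y)"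
proof
  have mem: "fst x i \<in> carrier G" "snd x i \<in> characters G F" "fst y i \<in> carrier G" "snd y i \<in> characters G F"
    if "i \<in> J" for i using x y that by (auto simp: ESC_def PiE_iff)
  have ext: "\<chi> \<in> extensional (carrier G)" if "\<chi> \<in> characters G F" for \<chi> :: "'a \<Rightarrow> 'f"
    using that by (simp add: characters_def)
  {
    assume "ESC_isomorphic G J x G J y"
    then obtain \<phi> \<sigma> where \<phi>: "\<phi> \<in> iso G G" and \<sigma>: "bij_betw \<sigma> J J"
      and eq: "\<And>i. i \<in> J \<Longrightarrow> \<phi> (fst x i) = fst y (\<sigma> i)"
        "\<And>i a. i \<in> J \<Longrightarrow> a \<in> carrier G \<Longrightarrow> snd y (\<sigma> i) (\<phi> a) = snd x i a"
      unfolding ESC_isomorphic_def by blast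
    \<comment> \<open>Elements of \<open>auto G\<close> are extensional, whereas an isomorphism is
      arbitrary outside the carrier.\<close>
    define f where "f = restrict \<phi> (carrier G)"
    have f: "f \<in> auto G"
      using \<phi> by (auto simp: f_def auto_def iso_def hom_def Bij_def)
    have "image_mset (auto_action F f) (ms x) = image_mset (\<lambda>i. (fst y (\<sigma> i), snd y (\<sigma> i))) (mset_set J)"
      unfolding ms_def image_mset.compositionality
    proof (rule image_mset_cong)
      fix i assume "i \<in># mset_set J"
      hence i: "i \<in> J" "\<sigma> i \<in> J" using J \<sigma> by (auto simp: bij_betw_def)
      have "compose (carrier G) (snd x i) (inv\<^bsub>AutoGroup G\<^esub> f) = snd y (\<sigma> i)"
      proof (rule extensionalityI[of _ "carrier G"])
        fix a assume a: "a \<in> carrier G"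
        let ?b = "(inv\<^bsub>AutoGroup G\<^esub> f) a"
        have b: "?b \<in> carrier G" using auto_closed[OF auto_inv(1)[OF f] a] .
        have "snd y (\<sigma> i) (\<phi> ?b) = snd x i ?b" by (rule eq(2)[OF i(1) b])
        moreover have "\<phi> ?b = a" using auto_inv(2)[OF f a] b by (simp add: f_def)
        ultimately show "compose (carrier G) (snd x i) (inv\<^bsub>AutoGroup G\<^esub> f) a = snd y (\<sigma> i) a"
          using a by (simp add: compose_def)
      qed (use ext mem i in auto)
      thus "(auto_action F f \<circ> (\<lambda>i. (fst x i, snd x i))) i = (fst y (\<sigma> i), snd y (\<sigma> i))"
        using i mem eq by (simp add: auto_action_def f_def)
    qed
    also have "\<dots> = image_mset (\<lambda>i. (fst y i, snd y i)) (image_mset \<sigma> (mset_set J))"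
      by (simp add: image_mset.compositionality comp_def)
    also have "image_mset \<sigma> (mset_set J) = mset_set J"
      using \<sigma> by (simp add: image_mset_mset_set bij_betw_def)
    finally show "\<exists>f \<in> auto G. image_mset (auto_action F f) (ms x) = ms y" using f by (auto simp: ms_def)
  }
  {
    assume "\<exists>f \<in> auto G. image_mset (auto_action F f) (ms x) = ms y"
    then obtain f where f: "f \<in> auto G" and eq: "image_mset (auto_action F f) (ms x) = ms y" by blast
    have eq': "image_mset (\<lambda>i. auto_action F f (fst x i, snd x i)) (mset_set J) =
        image_mset (\<lambda>i. (fst y i, snd y i)) (mset_set J)"
      using eq by (simp add: ms_def image_mset.compositionality comp_def)
    obtain \<sigma> where \<sigma>: "\<sigma> permutes J"
      and act: "\<forall>i \<in> J. auto_action F f (fst x i, snd x i) = (fst y (\<sigma> i), snd y (\<sigma> i))"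
      using image_mset_eq_implies_permutes[OF J eq'] .
    have "f \<in> iso G G" using f by (simp add: auto_def iso_def Bij_def)
    moreover have "bij_betw \<sigma> J J" by (rule permutes_imp_bij[OF \<sigma>])
    moreover have "f (fst x i) = fst y (\<sigma> i) \<and> (\<forall>a \<in> carrier G. snd y (\<sigma> i) (f a) = snd x i a)"
      if i: "i \<in> J" for i
    proof -
      have "f (fst x i) = fst y (\<sigma> i)" "snd y (\<sigma> i) = compose (carrier G) (snd x i) (inv\<^bsub>AutoGroup G\<^esub> f)"
        using bspec[OF act i] mem[OF i] by (auto simp: auto_action_def)
      thus ?thesis using auto_closed[OF f] auto_inv[OF f] by (simp add: compose_def)
    qed
    ultimately show "ESC_isomorphic G J x G J y" unfolding ESC_isomorphic_def by blast
  }
qed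

text \<open>For surjectivity, the multiset is listed and the positions of the list are matched with
  \<open>J\<close> along a bijection.\<close>

lemma image_ESC_multisets:
  assumes "finite J"
  shows "(\<lambda>x. image_mset (\<lambda>i. (fst x i, snd x i)) (mset_set J)) ` ESC G F J
    = multisets_of_size (carrier G \<times> characters G F) (card J)"
proof (intro equalityI subsetI)
  fix M assume "M \<in> multisets_of_size (carrier G \<times> characters G F) (card J)"
  hence M: "set_mset M \<subseteq> carrier G \<times> characters G F" "size M = card J"
    by (auto simp: multisets_of_size_def)
  obtain xs where xs: "mset xs = M" using ex_mset by blast
  obtain b where b: "bij_betw b J {..<card J}"
    using bij_betw_iff_card[of J "{..<card J}"] assms by auto
  have len: "length xs = card J" using M xs by auto
  have "image_mset (\<lambda>i. xs ! b i) (mset_set J) = image_mset (\<lambda>i. xs ! i) (image_mset b (mset_set J))"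
    by (simp add: image_mset.compositionality comp_def)
  also have "image_mset b (mset_set J) = mset_set {..<card J}"
    using b by (simp add: image_mset_mset_set bij_betw_def)
  also have "image_mset (\<lambda>i. xs ! i) (mset_set {..<card J}) = M"
  proof -
    have "mset (map (\<lambda>i. xs ! i) [0..<length xs]) = image_mset (\<lambda>i. xs ! i) (mset_set {0..<length xs})"
      by (simp only: mset_map mset_upt)
    hence "image_mset (\<lambda>i. xs ! i) (mset_set {0..<length xs}) = mset xs" by (simp only: map_nth)
    thus ?thesis using len xs by (simp add: atLeast0LessThan)
  qed
  finally have *: "image_mset (\<lambda>i. xs ! b i) (mset_set J) = M" .
  have mem: "xs ! b i \<in> carrier G \<times> characters G F" if "i \<in> J" for i
  proof -
    have "b i < length xs" using b that len by (auto simp: bij_betw_def)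
    from nth_mem[OF this] show ?thesis using M(1) xs by auto
  qed
  define x where "x = (\<lambda>i \<in> J. fst (xs ! b i), \<lambda>i \<in> J. snd (xs ! b i))"
  have "x \<in> ESC G F J" using mem by (auto simp: x_def ESC_def mem_Times_iff)
  moreover have "image_mset (\<lambda>i. (fst x i, snd x i)) (mset_set J) = M"
    unfolding *[symmetric] by (intro image_mset_cong) (use assms in \<open>simp add: x_def\<close>)
  ultimately show "M \<in> (\<lambda>x. image_mset (\<lambda>i. (fst x i, snd x i)) (mset_set J)) ` ESC G F J" by blast
qed (use assms in \<open>auto simp: multisets_of_size_def ESC_def PiE_iff\<close>)

text \<open>Isomorphism is the kernel relation of the map sending a system to the orbit of its
  multiset, and the values of this map are all the orbits.\<close>

lemma num_ESC_eq_card_orbits: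
  "num_ESC G F n = card (orbits (AutoGroup G) (multisets_of_size (carrier G \<times> characters G F) n)
     (\<lambda>f. \<lambda>M \<in> multisets_of_size (carrier G \<times> characters G F) n. image_mset (auto_action F f) M))"
proof -
  let ?X = "multisets_of_size (carrier G \<times> characters G F) n"
  let ?act = "\<lambda>f. \<lambda>M \<in> ?X. image_mset (auto_action F f) M"
  let ?ms = "\<lambda>x. image_mset (\<lambda>i. (fst x i, snd x i)) (mset_set {1..n})"
  interpret A: group_action "AutoGroup G" "carrier G \<times> characters G F" "auto_action F"
    by (rule group_action_auto)
  interpret M: group_action "AutoGroup G" ?X ?act by (rule A.group_action_multisets)
  have img: "?ms ` ESC G F {1..n} = ?X" using image_ESC_multisets[of "{1..n}" F] by simp
  have orbit_eq: "orbit (AutoGroup G) ?act M = orbit (AutoGroup G) ?act N \<longleftrightarrow> N \<in> orbit (AutoGroup G) ?act M"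
    if "M \<in> ?X" "N \<in> ?X" for M N
  proof
    assume "N \<in> orbit (AutoGroup G) ?act M"
    moreover have "orbit (AutoGroup G) ?act M' \<subseteq> ?X" if "M' \<in> ?X" for M'
      using that M.element_image by (fastforce simp: orbit_def)
    ultimately show "orbit (AutoGroup G) ?act M = orbit (AutoGroup G) ?act N"
      using that M.orbit_sym M.orbit_trans by (intro equalityI subsetI) blast+
  qed (use M.orbit_refl that in blast)
  have orbit_iff: "N \<in> orbit (AutoGroup G) ?act M \<longleftrightarrow> (\<exists>f \<in> auto G. image_mset (auto_action F f) M = N)"
    if "M \<in> ?X" for M N
    unfolding orbit_def AutoGroup_simps using that by auto
  have iff: "ESC_isomorphic G {1..n} x G {1..n} y \<longleftrightarrow>
      orbit (AutoGroup G) ?act (?ms x) = orbit (AutoGroup G) ?act (?ms y)"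
    if xy: "x \<in> ESC G F {1..n}" "y \<in> ESC G F {1..n}" for x y
  proof -
    have mem: "?ms x \<in> ?X" "?ms y \<in> ?X" using img xy by blast+
    show ?thesis
      unfolding orbit_eq[OF mem] orbit_iff[OF mem(1)] ESC_isomorphic_iff_multiset[OF finite_atLeastAtMost xy] ..
  qed
  have "ESC_iso_rel G F {1..n} = {(x, y). x \<in> ESC G F {1..n} \<and> y \<in> ESC G F {1..n} \<and>
      orbit (AutoGroup G) ?act (?ms x) = orbit (AutoGroup G) ?act (?ms y)}"
    unfolding ESC_iso_rel_def using iff by blast
  hence "num_ESC G F n = card ((\<lambda>x. orbit (AutoGroup G) ?act (?ms x)) ` ESC G F {1..n})"
    unfolding num_ESC_def by (simp only: card_quotient_kernel)
  also have "(\<lambda>x. orbit (AutoGroup G) ?act (?ms x)) ` ESC G F {1..n} = orbit (AutoGroup G) ?act ` ?X"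
    unfolding img[symmetric] image_image ..
  also have "\<dots> = orbits (AutoGroup G) ?X ?act" by (auto simp: orbits_def)
  finally show ?thesis .
qed

lemma num_ESC_burnside:
  assumes "finite (carrier G)" "finite (characters G F)"
  shows "real (num_ESC G F n) * real (card (auto G)) =
    (\<Sum>l \<in> cycle_types n. \<Sum>f \<in> auto G. \<Prod>t = 1..n.
       real (card {x \<in> carrier G. (f [^]\<^bsub>AutoGroup G\<^esub> t) x = x} *
             card {\<chi> \<in> characters G F. compose (carrier G) \<chi> (f [^]\<^bsub>AutoGroup G\<^esub> t) = \<chi>}) ^ l t
       / (fact (l t) * real t ^ l t))"
proof -
  interpret A: group_action "AutoGroup G" "carrier G \<times> characters G F" "auto_action F"
    by (rule group_action_auto)
  interpret AG: group "AutoGroup G" by (rule AutoGroup)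
  have "auto G \<subseteq> carrier G \<rightarrow>\<^sub>E carrier G" by (auto simp: auto_def hom_def Bij_def PiE_def)
  hence fin: "finite (auto G)"
    by (rule finite_subset) (use assms in \<open>auto intro: finite_PiE\<close>)
  have pow: "f [^]\<^bsub>AutoGroup G\<^esub> t \<in> auto G" if "f \<in> auto G" for f and t :: nat
    using AG.nat_pow_closed[of f t] that by (simp add: AutoGroup_simps)
  have "cycle_types n = weighted_partitions n n" by (auto simp: cycle_types_def weighted_partitions_def)
  thus ?thesis
    using A.card_orbits_multisets[of n] assms fin
    by (simp add: num_ESC_eq_card_orbits order_def AutoGroup_simps auto_action_fixed_points
        card_cartesian_product pow cong: sum.cong)
qed

end

section \<open>Sums over the units modulo a prime power\<close>

text \<open>The number \<open>gcd (x ^ t - 1) m ^ 2\<close> counts the pairs of an element and a character of a cyclic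
  group of order \<open>m\<close> that are fixed by the \<open>t\<close>-th iterate of the automorphism raising to the power
  \<open>x\<close>. The subtraction is only meaningful for \<open>x > 0\<close>, as it is for \<open>x\<close> in \<open>totatives m\<close>.\<close>

definition fix_weight :: "nat \<Rightarrow> (nat \<Rightarrow> nat) \<Rightarrow> nat \<Rightarrow> nat \<Rightarrow> nat" where
  "fix_weight n l m x = (\<Prod>t = 1..n. gcd (x ^ t - 1) m ^ (2 * l t))"

text \<open>Positivity makes \<open>x ^ t - 1\<close> a true difference, and its gcd with
  \<open>m\<close> depends only on its residue.\<close>

lemma fix_weight_cong:
  assumes "[x = y] (mod m)" "x > 0" "y > 0"
  shows "fix_weight n l m x = fix_weight n l m y"
proof -
  have "gcd (x ^ t - 1) m = gcd (y ^ t - 1) m" for t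
    using assms by (intro cong_gcd_eq cong_diff_nat cong_pow) auto
  thus ?thesis by (simp add: fix_weight_def)
qed

section \<open>Multiplicativity of the sum over units\<close>

lemma gcd_mult_coprime_right:
  fixes a b c :: nat
  assumes "coprime b c"
  shows "gcd a (b * c) = gcd a b * gcd a c"
proof (rule dvd_antisym)
  show "gcd a b * gcd a c dvd gcd a (b * c)"
    using assms by (intro gcd_greatest divides_mult mult_dvd_mono) (auto intro: coprime_divisors)
  obtain u v where uv: "gcd a (b * c) = u * v" "u dvd b" "v dvd c"
    using division_decomp[of "gcd a (b * c)" b c] by auto
  have "u dvd a" "v dvd a" using uv(1) gcd_dvd1[of a "b * c"] by (metis dvd_mult_left dvd_mult_right)+
  with uv show "gcd a (b * c) dvd gcd a b * gcd a c" by (simp add: mult_dvd_mono)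
qed

text \<open>By the Chinese remainder theorem the units modulo \<open>m1 * m2\<close> are the pairs
  of units modulo the factors, and each gcd in the weight splits accordingly.\<close>

lemma sum_fix_weight_mult:
  assumes "coprime m1 m2" "m1 > 0" "m2 > 0"
  shows "(\<Sum>x \<in> totatives (m1 * m2). fix_weight n l (m1 * m2) x) =
    (\<Sum>x \<in> totatives m1. fix_weight n l m1 x) * (\<Sum>x \<in> totatives m2. fix_weight n l m2 x)"
\<comment> \<open>A factor 1 is treated separately, since reduction modulo 1 gives 0 whereas
  \<open>totatives 1\<close> is \<open>{1}\<close>.\<close>
proof (cases "m1 > 1 \<and> m2 > 1")
  case False
  hence "m1 = 1 \<or> m2 = 1" using assms by auto
  thus ?thesis by (auto simp: fix_weight_def)
next
  case True
  have eq: "fix_weight n l (m1 * m2) x = fix_weight n l m1 (x mod m1) * fix_weight n l m2 (x mod m2)"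
    if "x \<in> totatives (m1 * m2)" for x
  proof -
    have "x > 0" using that by (simp add: in_totatives_iff)
    moreover have "(x mod m1, x mod m2) \<in> totatives m1 \<times> totatives m2"
      using bij_betw_apply[OF bij_betw_totatives[OF _ _ assms(1)] that] True by simp
    hence "x mod m1 \<in> totatives m1" "x mod m2 \<in> totatives m2" by simp_all
    ultimately have "fix_weight n l m1 (x mod m1) = fix_weight n l m1 x" "fix_weight n l m2 (x mod m2) = fix_weight n l m2 x"
      by (intro fix_weight_cong; simp add: in_totatives_iff)+
    thus ?thesis
      by (simp add: fix_weight_def gcd_mult_coprime_right[OF assms(1)] power_mult_distrib prod.distrib)
  qed
  have "(\<Sum>x \<in> totatives (m1 * m2). fix_weight n l (m1 * m2) x) =
      (\<Sum>(x, y) \<in> totatives m1 \<times> totatives m2. fix_weight n l m1 x * fix_weight n l m2 y)"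
    using sum.reindex_bij_betw[OF bij_betw_totatives[OF _ _ assms(1)],
        of "\<lambda>(x, y). fix_weight n l m1 x * fix_weight n l m2 y"] True eq
    by simp
  thus ?thesis by (simp add: sum_product sum.cartesian_product)
qed

lemma sum_fix_weight_prod:
  assumes "finite I" "\<And>i. i \<in> I \<Longrightarrow> q i > 0"
    "\<And>i j. i \<in> I \<Longrightarrow> j \<in> I \<Longrightarrow> i \<noteq> j \<Longrightarrow> coprime (q i) (q j)"
  shows "(\<Sum>x \<in> totatives (prod q I). fix_weight n l (prod q I) x) =
    (\<Prod>i \<in> I. \<Sum>x \<in> totatives (q i). fix_weight n l (q i) x)"
  using assms
proof (induction I)
  case (insert i I)
  have "coprime (q i) (prod q I)" using insert by (intro prod_coprime_right) auto
  moreover have "prod q I > 0" using insert by (intro prod_pos) auto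
  ultimately show ?case using insert by (simp add: sum_fix_weight_mult)
qed (simp add: fix_weight_def)

section \<open>The exponents as sums weighted by valuations\<close>

lemma sum_multiples:
  fixes h :: "nat \<Rightarrow> 'a::comm_monoid_add"
  assumes "c > 0"
  shows "(\<Sum>t | t \<in> {1..N} \<and> c dvd t. h t) = (\<Sum>s = 1..N div c. h (s * c))"
  by (rule sum.reindex_bij_witness[of _ "\<lambda>s. s * c" "\<lambda>t. t div c"])
    (use assms in \<open>auto simp: less_eq_div_iff_mult_less_eq div_le_mono dvd_div_mult_self dvd_imp_le Suc_le_eq div_greater_zero_iff\<close>)

text \<open>The indices are grouped by \<open>p\<close>-adic valuation, all valuations from
  \<open>E\<close> on sharing the cap \<open>k + E\<close>. Induction on \<open>E\<close> splits off
  the multiples of \<open>p\<close>: dividing such an index by \<open>p\<close> trades one unit of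
  valuation for one unit of \<open>k\<close>.\<close>

lemma sum_multiplicity_expansion:
  fixes l :: "nat \<Rightarrow> nat"
  assumes "prime p"
  shows "(\<Sum>s = 1..N. l s * min (k + E) (k + multiplicity p s)) =
    (\<Sum>u < E. (k + u) * (\<Sum>t | 1 \<le> t \<and> t \<le> N div p ^ u \<and> coprime t p. l (t * p ^ u)))
    + (k + E) * (\<Sum>t = 1..N div p ^ E. l (t * p ^ E))"
proof (induction E arbitrary: N l k)
  case 0
  show ?case by (simp add: sum_distrib_left mult.commute)
next
  case (Suc E)
  let ?h = "\<lambda>s. l s * min (k + Suc E) (k + multiplicity p s)"
  have cop: "coprime s p \<longleftrightarrow> \<not> p dvd s" for s
    using assms by (metis coprime_commute prime_imp_coprime coprime_absorb_left not_prime_unit)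
  have "(\<Sum>s = 1..N. ?h s) = (\<Sum>s | s \<in> {1..N} \<and> coprime s p. ?h s) + (\<Sum>s | s \<in> {1..N} \<and> p dvd s. ?h s)"
    by (subst sum.union_disjoint[symmetric]) (auto simp: cop intro!: sum.cong)
  also have "(\<Sum>s | s \<in> {1..N} \<and> coprime s p. ?h s) = k * (\<Sum>s | 1 \<le> s \<and> s \<le> N \<and> coprime s p. l s)"
    unfolding sum_distrib_left by (intro sum.cong) (auto simp: cop not_dvd_imp_multiplicity_0)
  also have "(\<Sum>s | s \<in> {1..N} \<and> p dvd s. ?h s) = (\<Sum>s = 1..N div p. ?h (s * p))"
    using assms by (intro sum_multiples prime_gt_0_nat)
  also have "\<dots> = (\<Sum>s = 1..N div p. l (s * p) * min (Suc k + E) (Suc k + multiplicity p s))"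
    using assms prime_gt_1_nat[OF assms]
    by (intro sum.cong refl arg_cong2[where f = "(*)"]) (auto simp: mult.commute[of _ p] multiplicity_times_same)
  also have "\<dots> = (\<Sum>u < E. (Suc k + u) * (\<Sum>t | 1 \<le> t \<and> t \<le> N div p div p ^ u \<and> coprime t p. l (t * p ^ u * p)))
    + (Suc k + E) * (\<Sum>t = 1..N div p div p ^ E. l (t * p ^ E * p))"
    by (rule Suc.IH)
  finally show ?case
    by (simp add: sum.lessThan_Suc_shift div_mult2_eq mult_ac del: sum.lessThan_Suc)
qed

text \<open>The coefficient of \<open>l t\<close> is the exponent of \<open>p\<close> in the gcd of
  \<open>gcd_primroot_power\<close>, which is the form in which the exponent arises. As
  \<open>d\<close> is prime to \<open>p\<close>, dividing an index by \<open>d\<close> keeps its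
  valuation.\<close>

lemma fexp_altdef:
  assumes "prime p" "coprime d p" "d > 0" "k \<le> e" "\<not> (p = 2 \<and> 3 \<le> e)"
  shows "fexp n p e k d l = (\<Sum>t = 1..n. l t * (if d dvd t then min e (k + multiplicity p t) else 0))"
proof -
  have mult: "multiplicity p (s * d) = multiplicity p s" if "s > 0" for s
  proof -
    have "\<not> p dvd d" using assms(1,2) by (metis coprime_absorb_right coprime_commute not_prime_unit)
    thus ?thesis using assms(1,3) that
      by (simp add: prime_elem_multiplicity_mult_distrib not_dvd_imp_multiplicity_0)
  qed
  have "(\<Sum>t = 1..n. l t * (if d dvd t then min e (k + multiplicity p t) else 0)) =
      (\<Sum>t | t \<in> {1..n} \<and> d dvd t. l t * min e (k + multiplicity p t))"
    by (rule sum.mono_neutral_cong_right) auto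
  also have "\<dots> = (\<Sum>s = 1..n div d. l (s * d) * min e (k + multiplicity p (s * d)))"
    using assms by (intro sum_multiples)
  also have "\<dots> = (\<Sum>s = 1..n div d. l (s * d) * min (k + (e - k)) (k + multiplicity p s))"
    using assms by (intro sum.cong) (auto simp: mult)
  finally show ?thesis
    unfolding sum_multiplicity_expansion[OF assms(1)] using assms
    by (auto simp: fexp_def atLeast0LessThan div_mult2_eq[symmetric] mult_ac)
qed

text \<open>The coefficients are the exponents in \<open>gcd_power_one_plus\<close>, so
  \<open>d = 1\<close> belongs to the units congruent to 1 modulo 4.\<close>

lemma fexp_two_one:
  assumes "3 \<le> e" "k \<le> e"
  shows "fexp n 2 e k 1 l = (\<Sum>t = 1..n. l t * min e (k + multiplicity 2 t))"
  using sum_multiplicity_expansion[OF two_is_prime_nat, of l k "e - k" n] assms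
  by (simp add: fexp_def atLeast0LessThan)

text \<open>Here \<open>d = 2\<close> belongs to the units congruent to 3 modulo 4: their odd powers
  minus 1 have exactly one factor 2, hence the coefficient 1 for odd \<open>t\<close>.\<close>

lemma fexp_two_two:
  assumes "3 \<le> e" "k \<le> e"
  shows "fexp n 2 e k 2 l = (\<Sum>t = 1..n. l t * (if odd t then 1 else min e (k + multiplicity 2 t)))"
proof -
  let ?h = "\<lambda>t. l t * (if odd t then 1 else min e (k + multiplicity 2 t))"
  have "(\<Sum>t = 1..n. ?h t) = (\<Sum>t | t \<in> {1..n} \<and> odd t. ?h t) + (\<Sum>t | t \<in> {1..n} \<and> 2 dvd t. ?h t)"
    by (subst sum.union_disjoint[symmetric]) (auto intro!: sum.cong)
  also have "(\<Sum>t | t \<in> {1..n} \<and> odd t. ?h t) = (\<Sum>t | 1 \<le> t \<and> t \<le> n \<and> coprime t 2. l t)"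
    by (intro sum.cong) (auto simp: coprime_right_2_iff_odd)
  also have "(\<Sum>t | t \<in> {1..n} \<and> 2 dvd t. ?h t) = (\<Sum>s = 1..n div 2. ?h (s * 2))"
    by (rule sum_multiples) simp
  \<comment> \<open>Halving an even index lowers its valuation by one, so \<open>k\<close> becomes
    \<open>Suc k\<close>.\<close>
  also have "\<dots> = (\<Sum>s = 1..n div 2. l (s * 2) * min e (Suc k + multiplicity 2 s))"
    by (intro sum.cong) (auto simp: mult.commute[of _ 2] multiplicity_times_same)
  also have "\<dots> = (if k < e then (\<Sum>u \<in> {1..<e - k}. (k + u) * (\<Sum>t | 1 \<le> t \<and> t \<le> n div 2 ^ u \<and> coprime t 2. l (t * 2 ^ u)))
           + e * (\<Sum>t = 1..n div 2 ^ (e - k). l (t * 2 ^ (e - k))) else e * (\<Sum>t = 1..n div 2. l (2 * t)))"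
  proof (cases "k < e")
    case True
    then obtain E where E: "e = Suc k + E" by (metis add_Suc less_iff_Suc_add)
    have "(\<Sum>u \<in> {1..<Suc E}. (k + u) * (\<Sum>t | 1 \<le> t \<and> t \<le> n div 2 ^ u \<and> coprime t 2. l (t * 2 ^ u))) =
      (\<Sum>u < E. (Suc k + u) * (\<Sum>t | 1 \<le> t \<and> t \<le> n div 2 div 2 ^ u \<and> coprime t 2. l (t * 2 ^ u * 2)))"
      unfolding One_nat_def sum.shift_bounds_Suc_ivl
      by (simp add: atLeast0LessThan div_mult2_eq mult_ac)
    thus ?thesis
      unfolding E sum_multiplicity_expansion[OF two_is_prime_nat, of "\<lambda>s. l (s * 2)" "Suc k" E]
      by (simp add: div_mult2_eq mult_ac)
  next
    \<comment> \<open>For \<open>k = e\<close> every even index already reaches the cap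
      \<open>e\<close>.\<close>
    case False
    thus ?thesis using assms by (simp add: sum_distrib_left mult_ac)
  qed
  finally show ?thesis using assms by (simp add: fexp_def)
qed

section \<open>Prime powers with a primitive root\<close>

text \<open>The gcd is some \<open>p ^ i\<close>, and putting \<open>j = i\<close> and
  \<open>j = w\<close> into the criterion forces \<open>i = w\<close>.\<close>

lemma gcd_prime_power_eqI:
  fixes p :: nat
  assumes "prime p" "w \<le> e" "\<And>j. 1 \<le> j \<Longrightarrow> j \<le> e \<Longrightarrow> p ^ j dvd a \<longleftrightarrow> j \<le> w"
  shows "gcd a (p ^ e) = p ^ w"
proof -
  obtain i where i: "i \<le> e" "gcd a (p ^ e) = p ^ i"
    using divides_primepow_nat[OF assms(1), of "gcd a (p ^ e)" e] by auto
  have "j \<le> i \<longleftrightarrow> j \<le> w" if "1 \<le> j" "j \<le> e" for j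
  proof -
    have "p ^ j dvd p ^ e" using that by (simp add: le_imp_power_dvd)
    hence "p ^ j dvd a \<longleftrightarrow> p ^ j dvd p ^ i" unfolding i(2)[symmetric] by simp
    also have "\<dots> \<longleftrightarrow> j \<le> i" using prime_gt_1_nat[OF assms(1)] by (simp add: dvd_power_iff_le)
    finally show ?thesis using assms(3)[OF that] by simp
  qed
  from this[of i] this[of w] have "i = w" using i assms(2) by (cases "i = 0"; cases "w = 0") auto
  with i show ?thesis by simp
qed

text \<open>The difference \<open>x ^ p - 1\<close> is \<open>x - 1\<close> times a geometric sum of
  \<open>p\<close> terms, each congruent to 1 modulo \<open>p\<close>, so the sum contributes
  another factor \<open>p\<close>.\<close>

lemma cong_1_power_lift:
  fixes p x :: nat
  assumes "[x = 1] (mod p ^ j)" "j \<ge> 1"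
  shows "[x ^ p = 1] (mod p ^ Suc j)"
proof -
  let ?x = "int x" and ?p = "int p"
  have x: "?p ^ j dvd ?x - 1"
    using assms(1) by (simp flip: cong_int_iff cong_iff_dvd_diff)
  have "[?x = 1] (mod ?p)"
    using x assms(2) by (auto simp: cong_iff_dvd_diff intro: dvd_trans[OF dvd_power[of j ?p]])
  hence "[(\<Sum>i < p. ?x ^ i) = (\<Sum>i < p. 1 ^ i)] (mod ?p)" by (intro cong_sum cong_pow)
  hence "?p dvd (\<Sum>i < p. ?x ^ i)" by (simp add: cong_dvd_iff)
  with x have "?p ^ j * ?p dvd (?x - 1) * (\<Sum>i < p. ?x ^ i)" by (rule mult_dvd_mono)
  hence "?p ^ Suc j dvd ?x ^ p - 1" by (simp add: power_diff_1_eq mult.commute)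
  thus ?thesis by (simp flip: cong_int_iff add: cong_iff_dvd_diff)
qed

text \<open>A congruence modulo \<open>p ^ j\<close> is lifted to \<open>p ^ e\<close> by
  \<open>e - j\<close> successive \<open>p\<close>-th powers. There the order of \<open>g\<close> is
  known, and cancelling \<open>p ^ (e - j)\<close> shows that \<open>g\<close> has full order modulo
  \<open>p ^ j\<close> already.\<close>

lemma primroot_power_cong_1_iff:
  assumes p: "prime p" and g: "residue_primroot (p ^ e) g" and j: "1 \<le> j" "j \<le> e"
  shows "[g ^ s = 1] (mod p ^ j) \<longleftrightarrow> p ^ (j - 1) * (p - 1) dvd s"
proof
  have cop: "coprime g p" and ord: "ord (p ^ e) g = totient (p ^ e)"
    using g j by (auto simp: residue_primroot_def coprime_commute)
  show "[g ^ s = 1] (mod p ^ j)" if "p ^ (j - 1) * (p - 1) dvd s"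
  proof -
    have "ord (p ^ j) g dvd totient (p ^ j)" using cop by (intro order_divides_totient) (simp add: coprime_commute)
    also have "totient (p ^ j) dvd s" using that j p by (simp add: totient_prime_power)
    finally show ?thesis using ord_divides by blast
  qed
  show "p ^ (j - 1) * (p - 1) dvd s" if "[g ^ s = 1] (mod p ^ j)"
  proof -
    have "[g ^ (s * p ^ i) = 1] (mod p ^ (j + i))" for i
    proof (induction i)
      case (Suc i)
      have "(g ^ (s * p ^ i)) ^ p = g ^ (s * p ^ Suc i)" by (metis power_mult power_Suc2 mult.assoc)
      with cong_1_power_lift[OF Suc] j show ?case by simp
    qed (use that in simp)
    from this[of "e - j"] have "totient (p ^ e) dvd s * p ^ (e - j)"
      using j ord ord_divides[of g "s * p ^ (e - j)" "p ^ e"] by simp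
    moreover have "p ^ (e - 1) = p ^ (j - 1) * p ^ (e - j)" using j by (simp flip: power_add)
    hence "totient (p ^ e) = (p ^ (j - 1) * (p - 1)) * p ^ (e - j)"
      using j p by (simp add: totient_prime_power)
    ultimately have "(p ^ (j - 1) * (p - 1)) * p ^ (e - j) dvd s * p ^ (e - j)" by metis
    moreover have "p ^ (e - j) \<noteq> 0" using prime_gt_0_nat[OF p] by simp
    ultimately show ?thesis by (metis dvd_times_right_cancel_iff)
  qed
qed

lemma divisor_pred_prime:
  assumes "prime p" "d dvd p - (1::nat)"
  shows "\<not> p dvd d" "d > 0" "(p - 1) div d > 0" "p - 1 = (p - 1) div d * d"
proof -
  have p: "p > 1" using prime_gt_1_nat[OF assms(1)] .
  show "\<not> p dvd d"
  proof
    assume "p dvd d"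
    hence "p dvd p - 1" using assms(2) dvd_trans by blast
    hence "p \<le> p - 1" using p by (intro dvd_imp_le) auto
    thus False using p by simp
  qed
  show *: "p - 1 = (p - 1) div d * d" using assms(2) by simp
  show "d > 0" "(p - 1) div d > 0" using * p by (metis gr0I mult_0 mult_0_right zero_less_diff less_irrefl)+
qed

text \<open>By the order criterion, \<open>p ^ j\<close> divides the difference iff
  \<open>p ^ (j - 1) * (p - 1)\<close> divides \<open>b * t\<close>. Inserting the given gcd and
  cancelling \<open>(p - 1) div d\<close> leaves a bound on \<open>j\<close> by the valuation of
  \<open>t\<close> and the condition \<open>d dvd t\<close>.\<close>

lemma gcd_primroot_power:
  assumes p: "prime p" and g: "residue_primroot (p ^ e) g" and k: "1 \<le> k" "k \<le> e" and d: "d dvd p - 1"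
    and b: "gcd b (p ^ (e - 1) * (p - 1)) = p ^ (k - 1) * ((p - 1) div d)" and t: "t > 0"
  shows "gcd ((g ^ b) ^ t - 1) (p ^ e) = p ^ (if d dvd t then min e (k + multiplicity p t) else 0)"
proof (rule gcd_prime_power_eqI[OF p])
  fix j assume j: "1 \<le> j" "j \<le> e"
  have p1: "p > 1" using prime_gt_1_nat[OF p] .
  define c where "c = (p - 1) div d"
  have c: "p - 1 = c * d" "c > 0" using divisor_pred_prime[OF p d] by (simp_all add: c_def)
  have pd: "coprime d p" using divisor_pred_prime(1)[OF p d] prime_imp_coprime[OF p] coprime_commute by blast
  have "g > 0" using g p1 k by (cases g) (auto simp: residue_primroot_def)
  hence "p ^ j dvd (g ^ b) ^ t - 1 \<longleftrightarrow> [g ^ (b * t) = 1] (mod p ^ j)"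
    using cong_altdef_nat[of 1 "g ^ (b * t)" "p ^ j"] by (simp add: power_mult Suc_le_eq)
  also have "\<dots> \<longleftrightarrow> p ^ (j - 1) * (p - 1) dvd b * t" by (rule primroot_power_cong_1_iff[OF p g j])
  \<comment> \<open>The divisor also divides \<open>p ^ (e - 1) * (p - 1) * t\<close>, so it may be
    tested on the gcd; this brings in the assumption on \<open>b\<close>.\<close>
  also have "\<dots> \<longleftrightarrow> p ^ (j - 1) * (p - 1) dvd gcd (b * t) (p ^ (e - 1) * (p - 1) * t)"
  proof -
    have "p ^ (j - 1) * (p - 1) dvd p ^ (e - 1) * (p - 1) * t"
      using j by (intro dvd_mult2 mult_dvd_mono le_imp_power_dvd) auto
    thus ?thesis by simp
  qed
  also have "gcd (b * t) (p ^ (e - 1) * (p - 1) * t) = p ^ (k - 1) * c * t"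
    using b by (metis c_def gcd_mult_distrib_nat mult.commute)
  also have "p ^ (j - 1) * (p - 1) dvd p ^ (k - 1) * c * t \<longleftrightarrow> p ^ (j - 1) * d dvd p ^ (k - 1) * t"
  proof -
    have "p ^ (j - 1) * (p - 1) = c * (p ^ (j - 1) * d)" "p ^ (k - 1) * c * t = c * (p ^ (k - 1) * t)"
      using c(1) by simp_all
    thus ?thesis using c(2) by (simp only: dvd_mult_cancel1 nat_mult_dvd_cancel1)
  qed
  also have "\<dots> \<longleftrightarrow> p ^ (j - 1) dvd p ^ (k - 1) * t \<and> d dvd p ^ (k - 1) * t"
  proof -
    have "coprime (p ^ (j - 1)) d" using pd by (simp add: coprime_commute)
    thus ?thesis by (meson divides_mult dvd_mult_left dvd_mult_right)
  qed
  also have "d dvd p ^ (k - 1) * t \<longleftrightarrow> d dvd t"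
    using pd by (intro coprime_dvd_mult_right_iff) simp
  also have "p ^ (j - 1) dvd p ^ (k - 1) * t \<longleftrightarrow> j - 1 \<le> k - 1 + multiplicity p t"
    using p t by (subst power_dvd_iff_le_multiplicity)
      (auto simp: prime_elem_multiplicity_mult_distrib)
  \<comment> \<open>If \<open>d\<close> does not divide \<open>t\<close>, no
    \<open>j \<ge> 1\<close> qualifies and the exponent is 0; otherwise the shifts of
    \<open>j\<close> and \<open>k\<close> by one cancel.\<close>
  finally show "p ^ j dvd (g ^ b) ^ t - 1 \<longleftrightarrow> j \<le> (if d dvd t then min e (k + multiplicity p t) else 0)"
    using j k by auto
qed simp

text \<open>The exponents run from 1 to \<open>totient m\<close>, the range in which
  \<open>card_gcd_eq_totient\<close> counts; by Euler's theorem \<open>totient m\<close> may replace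
  the exponent 0.\<close>

lemma sum_totatives_primroot:
  assumes "m > 1" "residue_primroot m g"
  shows "(\<Sum>x \<in> totatives m. h x) = (\<Sum>b \<in> {0<..totient m}. h (g ^ b mod m))"
proof -
  let ?N = "totient m"
  have N: "?N > 0" using assms(1) by simp
  have "g ^ ?N mod m = g ^ 0 mod m"
    using euler_theorem[of g m] assms(2) by (simp add: residue_primroot_def coprime_commute cong_def)
  moreover have "{..<?N} = insert 0 {0<..<?N}" "{0<..?N} = insert ?N {0<..<?N}" using N by auto
  ultimately have "(\<Sum>b < ?N. h (g ^ b mod m)) = (\<Sum>b \<in> {0<..?N}. h (g ^ b mod m))" by simp
  thus ?thesis
    using sum.reindex_bij_betw[OF residue_primroot_is_generator[OF assms], of h] by simp
qed

text \<open>Exactly \<open>totient (N div D)\<close> numbers in \<open>{0<..N}\<close> have gcd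
  \<open>D\<close> with \<open>N\<close>. The set \<open>B\<close> may leave out some gcds, so that
  the lemma serves both for all exponents of a primitive root and for the multiples of 4 modulo a
  power of two.\<close>

lemma sum_by_gcd:
  fixes h :: "nat \<Rightarrow> nat"
  assumes "N > 0" "finite K" "inj_on \<delta> K" "\<And>\<kappa>. \<kappa> \<in> K \<Longrightarrow> \<delta> \<kappa> dvd N"
    and "\<And>b. b \<in> B \<longleftrightarrow> b \<in> {0<..N} \<and> gcd b N \<in> \<delta> ` K"
    and "\<And>b \<kappa>. b \<in> {0<..N} \<Longrightarrow> \<kappa> \<in> K \<Longrightarrow> gcd b N = \<delta> \<kappa> \<Longrightarrow> h b = H \<kappa>"
  shows "(\<Sum>b \<in> B. h b) = (\<Sum>\<kappa> \<in> K. totient (N div \<delta> \<kappa>) * H \<kappa>)"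
proof -
  have "B \<subseteq> {0<..N}" using assms(5) by blast
  hence "finite B" by (rule finite_subset) simp
  have "(\<Sum>b \<in> B. h b) = (\<Sum>D \<in> \<delta> ` K. \<Sum>b | b \<in> B \<and> gcd b N = D. h b)"
    using \<open>finite B\<close> assms(2,5) by (intro sum.group[symmetric]) auto
  also have "\<dots> = (\<Sum>\<kappa> \<in> K. \<Sum>b | b \<in> B \<and> gcd b N = \<delta> \<kappa>. h b)"
    using assms(3) by (simp add: sum.reindex)
  also have "\<dots> = (\<Sum>\<kappa> \<in> K. totient (N div \<delta> \<kappa>) * H \<kappa>)"
  proof (intro sum.cong refl)
    fix \<kappa> assume \<kappa>: "\<kappa> \<in> K"
    have "{b. b \<in> B \<and> gcd b N = \<delta> \<kappa>} = {b \<in> {0<..N}. gcd b N = \<delta> \<kappa>}"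
      using \<kappa> assms(5) by auto
    hence "(\<Sum>b | b \<in> B \<and> gcd b N = \<delta> \<kappa>. h b) = (\<Sum>b \<in> {b \<in> {0<..N}. gcd b N = \<delta> \<kappa>}. H \<kappa>)"
      using \<kappa> assms(6) by (intro sum.cong) auto
    thus "(\<Sum>b | b \<in> B \<and> gcd b N = \<delta> \<kappa>. h b) = totient (N div \<delta> \<kappa>) * H \<kappa>"
      using card_gcd_eq_totient[OF assms(1) assms(4)[OF \<kappa>]] by simp
  qed
  finally show ?thesis .
qed

text \<open>The unit \<open>g ^ b\<close> contributes according to the gcd of \<open>b\<close> with
  the order of the unit group, and the divisors of this order are uniquely
  \<open>p ^ (k - 1) * ((p - 1) div d)\<close>.\<close>

lemma sum_fix_weight_primroot:
  assumes p: "prime p" and e: "e \<ge> 1" "odd p \<or> e \<le> 2"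
  shows "(\<Sum>x \<in> totatives (p ^ e). fix_weight n l (p ^ e) x) =
    (\<Sum>k = 1..e. \<Sum>d | d dvd p - 1. totient (p ^ (e - k) * d) * p ^ (2 * fexp n p e k d l))"
proof -
  have p1: "p > 1" using prime_gt_1_nat[OF p] .
  define K where "K = {1..e} \<times> {d. d dvd p - 1}"
  define N where "N = totient (p ^ e)"
  \<comment> \<open>The gcd belonging to \<open>(k, d)\<close>: its cofactor in \<open>N\<close> is
    \<open>p ^ (e - k) * d\<close>, whose totient is the coefficient in the formula.\<close>
  define \<delta> where "\<delta> = (\<lambda>(k, d). p ^ (k - 1) * ((p - 1) div d))"
  have N: "N = p ^ (e - 1) * (p - 1)" using e p by (simp add: N_def totient_prime_power)
  have N0: "N > 0" using p1 by (simp add: N)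
  have pe: "p ^ e > 1" using p1 e by (intro one_less_power) auto
  have "p ^ e \<in> cyclic_moduli"
  proof (cases "odd p")
    case True
    moreover have "e > 0" using e by simp
    ultimately show ?thesis unfolding cyclic_moduli_def using p by blast
  next
    case False
    hence "p = 2" using prime_odd_nat[OF p] p1 by (cases "p > 2") auto
    moreover have "e = 1 \<or> e = 2" using e False by auto
    ultimately show ?thesis by (auto simp: cyclic_moduli_def)
  qed
  then obtain g where g: "residue_primroot (p ^ e) g"
    using residue_primroot_iff_in_cyclic_moduli by blast
  have g0: "g > 0" using g pe by (cases g) (auto simp: residue_primroot_def)
  have ndvd: "\<not> p dvd c" if "c dvd p - 1" for c
    using divisor_pred_prime(1)[OF p that] .
  have fin: "finite K" using p1 by (simp add: K_def)
  have K_dvd: "\<delta> \<kappa> dvd N" if "\<kappa> \<in> K" for \<kappa>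
    using that unfolding N by (auto simp: K_def \<delta>_def intro!: mult_dvd_mono le_imp_power_dvd)
  have inj: "inj_on \<delta> K"
  proof (rule inj_onI, clarsimp simp: K_def)
    fix k d k' d' assume *: "Suc 0 \<le> k" "Suc 0 \<le> k'" "d dvd p - Suc 0" "d' dvd p - Suc 0" "\<delta> (k, d) = \<delta> (k', d')"
    \<comment> \<open>The valuation recovers \<open>k\<close>, because \<open>(p - 1) div d\<close>
      is prime to \<open>p\<close>.\<close>
    have m: "multiplicity p (\<delta> (k, d)) = k - 1" if "d dvd p - 1" for k d
    proof -
      have "(p - 1) div d dvd p - 1" using divisor_pred_prime(4)[OF p that] by (metis dvd_triv_left)
      hence "\<not> p dvd (p - 1) div d" "(p - 1) div d \<noteq> 0" using ndvd divisor_pred_prime(3)[OF p that] by auto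
      thus ?thesis using p by (simp add: \<delta>_def prime_elem_multiplicity_mult_distrib not_dvd_imp_multiplicity_0)
    qed
    have dd: "d dvd p - 1" "d' dvd p - 1" using * by simp_all
    have "k = k'" using m[OF dd(1), of k] m[OF dd(2), of k'] * by simp
    moreover from this have "(p - 1) div d = (p - 1) div d'" using *(5) p1 by (simp add: \<delta>_def)
    hence "d = d'" using divisor_pred_prime(3,4)[OF p dd(1)] divisor_pred_prime(4)[OF p dd(2)]
      by (metis mult_cancel1 less_irrefl)
    ultimately show "k = k' \<and> d = d'" by simp
  qed
  have cover: "gcd b N \<in> \<delta> ` K" for b
  proof -
    obtain u c where uc: "gcd b N = u * c" "u dvd p ^ (e - 1)" "c dvd p - 1"
      using division_decomp[of "gcd b N" "p ^ (e - 1)" "p - 1"] N by auto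
    obtain i where i: "i \<le> e - 1" "u = p ^ i" using uc(2) divides_primepow_nat[OF p] by auto
    have d: "(p - 1) div c dvd p - 1" using divisor_pred_prime(4)[OF p uc(3)] by (metis dvd_triv_left)
    have "(p - 1) div ((p - 1) div c) = c"
      using divisor_pred_prime(3,4)[OF p uc(3)] by (metis nonzero_mult_div_cancel_left less_irrefl)
    hence "gcd b N = \<delta> (Suc i, (p - 1) div c)" using uc i by (simp add: \<delta>_def)
    moreover have "(Suc i, (p - 1) div c) \<in> K" using i e d by (auto simp: K_def)
    ultimately show ?thesis by blast
  qed
  have weight: "fix_weight n l (p ^ e) (g ^ b mod p ^ e) = p ^ (2 * fexp n p e k d l)"
    if kd: "(k, d) \<in> K" and b: "gcd b N = \<delta> (k, d)" for b k d
  proof -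
    have kd': "1 \<le> k" "k \<le> e" "d dvd p - 1" using kd by (auto simp: K_def)
    have "d > 0" using divisor_pred_prime(2)[OF p kd'(3)] .
    have "coprime d p" using ndvd[OF kd'(3)] prime_imp_coprime[OF p] by (simp add: coprime_commute)
    \<comment> \<open>A power of \<open>g\<close> is a unit, so its residue is positive, as
      \<open>fix_weight_cong\<close> requires.\<close>
    have "coprime (g ^ b) (p ^ e)" using g by (auto simp: residue_primroot_def coprime_commute)
    from coprime_common_divisor[OF this, of "p ^ e"] have "\<not> p ^ e dvd g ^ b" using pe by auto
    hence "g ^ b mod p ^ e > 0" by (simp add: mod_greater_zero_iff_not_dvd)
    hence "fix_weight n l (p ^ e) (g ^ b mod p ^ e) = fix_weight n l (p ^ e) (g ^ b)"
      using g0 by (intro fix_weight_cong) auto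
    also have "\<dots> = (\<Prod>t = 1..n. p ^ (2 * (l t * (if d dvd t then min e (k + multiplicity p t) else 0))))"
      unfolding fix_weight_def
    proof (intro prod.cong refl)
      fix t assume "t \<in> {1..n}"
      hence "gcd ((g ^ b) ^ t - 1) (p ^ e) = p ^ (if d dvd t then min e (k + multiplicity p t) else 0)"
        using b by (intro gcd_primroot_power[OF p g kd']) (auto simp: N \<delta>_def)
      thus "gcd ((g ^ b) ^ t - 1) (p ^ e) ^ (2 * l t) =
          p ^ (2 * (l t * (if d dvd t then min e (k + multiplicity p t) else 0)))"
        by (simp only: power_mult [symmetric] mult_ac)
    qed
    also have "\<dots> = p ^ (2 * fexp n p e k d l)"
      using e(2) kd' by (subst fexp_altdef[OF p \<open>coprime d p\<close> \<open>d > 0\<close>]) (auto simp: power_sum sum_distrib_left)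
    finally show ?thesis .
  qed
  have "(\<Sum>x \<in> totatives (p ^ e). fix_weight n l (p ^ e) x) =
      (\<Sum>b \<in> {0<..N}. fix_weight n l (p ^ e) (g ^ b mod p ^ e))"
    unfolding N_def by (rule sum_totatives_primroot[OF pe g])
  also have "\<dots> = (\<Sum>\<kappa> \<in> K. totient (N div \<delta> \<kappa>) * (case \<kappa> of (k, d) \<Rightarrow> p ^ (2 * fexp n p e k d l)))"
    by (rule sum_by_gcd[OF N0 fin inj K_dvd]) (use cover weight in auto)
  also have "\<dots> = (\<Sum>(k, d) \<in> K. totient (p ^ (e - k) * d) * p ^ (2 * fexp n p e k d l))"
  proof (intro sum.cong refl, clarify)
    fix k d assume "(k, d) \<in> K"
    hence kd: "1 \<le> k" "k \<le> e" "d dvd p - 1" by (auto simp: K_def)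
    define c where "c = (p - 1) div d"
    have c: "p - 1 = c * d" "c > 0" using divisor_pred_prime[OF p kd(3)] by (simp_all add: c_def)
    have pow: "p ^ (e - 1) = p ^ (k - 1) * p ^ (e - k)" using kd by (simp flip: power_add)
    have \<delta>: "\<delta> (k, d) = p ^ (k - 1) * c" by (simp add: \<delta>_def c_def)
    have "N = (p ^ (e - k) * d) * \<delta> (k, d)" unfolding N \<delta> pow c(1) by (simp only: mult_ac)
    moreover have "\<delta> (k, d) > 0" using c p1 by (simp add: \<delta>)
    ultimately show "totient (N div \<delta> (k, d)) * p ^ (2 * fexp n p e k d l) =
        totient (p ^ (e - k) * d) * p ^ (2 * fexp n p e k d l)" by simp
  qed
  also have "\<dots> = (\<Sum>k = 1..e. \<Sum>d | d dvd p - 1. totient (p ^ (e - k) * d) * p ^ (2 * fexp n p e k d l))"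
    using p1 by (simp add: K_def sum.cartesian_product)
  finally show ?thesis .
qed

section \<open>Powers of two without a primitive root\<close>

text \<open>For odd \<open>t\<close> the cofactor of \<open>z\<close> is a geometric sum of oddly
  many odd terms. For \<open>t = 2 * s\<close>, squaring \<open>1 + y\<close> with
  \<open>y = 4 * w\<close> gives \<open>1 + y * 2 * (1 + 2 * w)\<close>, so each doubling of the
  exponent adds exactly one factor 2.\<close>

lemma power_one_plus_multiple_of_4:
  fixes z :: nat
  assumes "4 dvd z" "t > 0"
  shows "\<exists>r. odd r \<and> (1 + z) ^ t = 1 + z * 2 ^ multiplicity 2 t * r"
  using assms(2)
proof (induction t rule: less_induct)
  case (less t)
  show ?case
  proof (cases "odd t")
    case True
    have geo: "(1 + z) ^ m = 1 + z * (\<Sum>i < m. (1 + z) ^ i)" for m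
      by (induction m) (auto simp: algebra_simps)
    have "even z" using assms(1) by (rule dvd_trans[rotated]) simp
    hence "even (\<Sum>i < m. (1 + z) ^ i) \<longleftrightarrow> even m" for m by (induction m) auto
    with True geo[of t] show ?thesis
      by (intro exI[of _ "\<Sum>i < t. (1 + z) ^ i"]) (simp add: not_dvd_imp_multiplicity_0)
  next
    case False
    then obtain s where s: "t = 2 * s" by blast
    obtain r where r: "odd r" "(1 + z) ^ s = 1 + z * 2 ^ multiplicity 2 s * r"
      using less.IH[of s] less.prems s by auto
    define y where "y = z * 2 ^ multiplicity 2 s * r"
    have "4 dvd y" unfolding y_def using assms(1) by (intro dvd_mult2)
    then obtain w where w: "y = 4 * w" by blast
    have "(1 + z) ^ t = ((1 + z) ^ s) ^ 2" by (metis s mult.commute power_mult)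
    also have "\<dots> = (1 + y) ^ 2" using r by (simp add: y_def)
    also have "\<dots> = 1 + y * 2 * (1 + 2 * w)" by (simp add: power2_eq_square algebra_simps w)
    also have "y * 2 * (1 + 2 * w) = z * 2 ^ multiplicity 2 t * (r * (1 + 2 * w))"
    proof -
      have "multiplicity 2 t = Suc (multiplicity 2 s)"
        using less.prems by (simp add: s multiplicity_times_same)
      thus ?thesis by (simp add: y_def algebra_simps)
    qed
    finally have "(1 + z) ^ t = 1 + z * 2 ^ multiplicity 2 t * (r * (1 + 2 * w))" .
    moreover have "odd (r * (1 + 2 * w))" using r(1) by simp
    ultimately show ?thesis by blast
  qed
qed

text \<open>The odd cofactor drops out, and the valuation of \<open>t\<close> is added to
  \<open>k\<close> up to the cap \<open>e\<close>. Describing \<open>z\<close> by a gcd includes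
  \<open>z = 0\<close>, with \<open>k = e\<close>.\<close>

lemma gcd_power_one_plus:
  fixes z :: nat
  assumes "gcd z (2 ^ e) = 2 ^ k" "2 \<le> k" "t > 0"
  shows "gcd ((1 + z) ^ t - 1) (2 ^ e) = 2 ^ min e (k + multiplicity 2 t)"
proof -
  let ?v = "multiplicity 2 t"
  have "(4::nat) dvd 2 ^ k" using le_imp_power_dvd[OF assms(2), of "2::nat"] by simp
  also have "2 ^ k dvd z" using assms(1) by (metis gcd_dvd1)
  finally obtain r where r: "odd r" "(1 + z) ^ t = 1 + z * 2 ^ ?v * r"
    using power_one_plus_multiple_of_4 assms(3) by blast
  have gcd_2: "gcd (2 ^ a) (2 ^ b :: nat) = 2 ^ min a b" for a b
    by (cases a b rule: le_cases) (simp_all add: le_imp_power_dvd gcd_proj1_iff gcd_proj2_iff)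
  have "gcd ((1 + z) ^ t - 1) (2 ^ e) = gcd (z * 2 ^ ?v * r) (2 ^ e)" using r by simp
  also have "\<dots> = gcd (z * 2 ^ ?v) (2 ^ e)"
    using r(1) by (intro gcd_mult_left_right_cancel) simp
  \<comment> \<open>As \<open>2 ^ e\<close> divides \<open>2 ^ e * 2 ^ ?v\<close>, the inner gcd may
    be inserted; it is a multiple of the known gcd of \<open>z\<close>.\<close>
  also have "\<dots> = gcd (gcd (z * 2 ^ ?v) (2 ^ e * 2 ^ ?v)) (2 ^ e)"
    by (simp add: gcd.assoc)
  also have "gcd (z * 2 ^ ?v) (2 ^ e * 2 ^ ?v) = 2 ^ (k + ?v)"
    using assms(1) gcd_mult_distrib_nat[of "2 ^ ?v" z "2 ^ e"] by (simp add: mult.commute power_add)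
  finally show ?thesis by (simp add: gcd_2 min.commute)
qed

text \<open>These units are \<open>1 + z\<close> with \<open>4 dvd z\<close> and
  \<open>z < 2 ^ e\<close>, and they are grouped by the gcd of \<open>z\<close> with
  \<open>2 ^ e\<close>.\<close>

lemma sum_totatives_1_mod_4:
  fixes h :: "nat \<Rightarrow> nat"
  assumes e: "e \<ge> 2" and H: "\<And>z k. 2 \<le> k \<Longrightarrow> k \<le> e \<Longrightarrow> gcd z (2 ^ e) = 2 ^ k \<Longrightarrow> h (1 + z) = H k"
  shows "(\<Sum>x | x \<in> totatives (2 ^ e) \<and> x mod 4 = 1. h x) = (\<Sum>k = 2..e. totient (2 ^ (e - k)) * H k)"
proof -
  let ?q = "2 ^ e :: nat"
  define M where "M = {z \<in> {0<..<?q}. 4 dvd z}"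
  have q: "4 dvd ?q" using le_imp_power_dvd[OF e, of "2::nat"] by simp
  have q1: "?q > 1" using e by (intro one_less_power) auto
  have dvd_q: "d dvd ?q" if "d dvd 4" for d using that q dvd_trans by blast
  have "(\<Sum>x | x \<in> totatives ?q \<and> x mod 4 = 1. h x) = (\<Sum>z \<in> insert 0 M. h (1 + z))"
  proof (rule sum.reindex_bij_witness[of _ "\<lambda>z. 1 + z" "\<lambda>x. x - 1"])
    fix x assume x: "x \<in> {x. x \<in> totatives ?q \<and> x mod 4 = 1}"
    hence "x > 0" "x \<le> ?q" by (auto simp: in_totatives_iff)
    moreover from x q have "x \<noteq> ?q" by auto
    moreover have "4 dvd x - 1" using x mod_eq_dvd_iff_nat[of 1 x 4] \<open>x > 0\<close> by simp
    ultimately show "x - 1 \<in> insert 0 M" "1 + (x - 1) = x" "h (1 + (x - 1)) = h x" by (auto simp: M_def)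
  next
    fix z assume z: "z \<in> insert 0 M"
    hence z4: "4 dvd z" "z < ?q" using q1 by (auto simp: M_def)
    hence "even z" by (metis dvd_trans even_numeral)
    moreover have "(1 + z) mod 4 = 1" using z4 by auto
    ultimately show "1 + z \<in> {x. x \<in> totatives ?q \<and> x mod 4 = 1}"
      using z4 e by (simp add: in_totatives_iff)
  qed simp
  also have "\<dots> = h 1 + (\<Sum>z \<in> M. h (1 + z))" by (subst sum.insert) (auto simp: M_def)
  \<comment> \<open>The value \<open>z = 0\<close> is exchanged for \<open>z = 2 ^ e\<close>, which
    has the same gcd, to fit the range of \<open>sum_by_gcd\<close>.\<close>
  also have "h 1 = h (1 + ?q)" using H[OF e order.refl, of 0] H[OF e order.refl, of ?q] by simp
  also have "\<dots> + (\<Sum>z \<in> M. h (1 + z)) = (\<Sum>z \<in> insert ?q M. h (1 + z))"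
    by (subst sum.insert) (auto simp: M_def)
  also have "\<dots> = (\<Sum>k = 2..e. totient (?q div 2 ^ k) * H k)"
  proof (rule sum_by_gcd)
    fix b
    show "b \<in> insert ?q M \<longleftrightarrow> b \<in> {0<..?q} \<and> gcd b ?q \<in> (\<lambda>k. 2 ^ k) ` {2..e}"
    proof -
      obtain i where i: "i \<le> e" "gcd b ?q = 2 ^ i"
        using divides_primepow_nat[OF two_is_prime_nat, of "gcd b ?q" e] by auto
      have "4 dvd b \<longleftrightarrow> 2 ^ 2 dvd (2 ^ i :: nat)" unfolding i(2)[symmetric] using q by simp
      also have "\<dots> \<longleftrightarrow> i \<in> {2..e}" using i by (subst dvd_power_iff_le) auto
      also have "\<dots> \<longleftrightarrow> gcd b ?q \<in> (\<lambda>k. 2 ^ k) ` {2..e}" using i by auto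
      finally show ?thesis using q by (auto simp: M_def)
    qed
  qed (use H in \<open>auto simp: inj_on_def le_imp_power_dvd\<close>)
  also have "\<dots> = (\<Sum>k = 2..e. totient (2 ^ (e - k)) * H k)"
    by (intro sum.cong) (auto simp: power_diff)
  finally show ?thesis .
qed

lemma minus_mod_4:
  fixes Q x :: nat
  assumes "x < 4 * Q" "x mod 4 > 0"
  shows "(4 * Q - x) mod 4 = 4 - x mod 4"
proof -
  have "x = 4 * (x div 4) + x mod 4" "x mod 4 < 4" by simp_all
  hence "4 * Q - x = (4 - x mod 4) + 4 * (Q - x div 4 - 1)" using assms by linarith
  hence "(4 * Q - x) mod 4 = (4 - x mod 4) mod 4" by (simp only: mod_mult_self2)
  thus ?thesis using assms by simp
qed

lemma four_power: "(4 :: nat) ^ a = 2 ^ (2 * a)"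
  by (simp add: power_mult)

text \<open>Negation matches the units congruent to 3 modulo 4 with those congruent to 1. It leaves
  even powers unchanged modulo \<open>2 ^ e\<close>, while an odd power of a unit congruent to 3
  exceeds 1 by twice an odd number.\<close>

lemma sum_fix_weight_two_power:
  assumes e: "e \<ge> 3"
  shows "(\<Sum>x \<in> totatives (2 ^ e). fix_weight n l (2 ^ e) x) =
    (\<Sum>k = 2..e. \<Sum>d = 1..2. totient (2 ^ (e - k)) * 4 ^ fexp n 2 e k d l)"
proof -
  let ?q = "2 ^ e :: nat"
  let ?f = "fix_weight n l ?q"
  \<comment> \<open>The weight of \<open>2 ^ e - y\<close> expressed through \<open>y\<close>, for
    \<open>y\<close> congruent to 1 modulo 4.\<close>
  define f' where "f' = (\<lambda>y. \<Prod>t = 1..n. (if odd t then 2 else gcd (y ^ t - 1) ?q) ^ (2 * l t))"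
  define A where "A = (\<lambda>r. {x. x \<in> totatives ?q \<and> x mod 4 = r})"
  have q: "4 dvd ?q" using le_imp_power_dvd[of 2 e "2::nat"] e by simp
  have odd_A: "odd x" if "x \<in> totatives ?q" for x
    using that e by (auto simp: in_totatives_iff)
  have lt: "x < ?q" if "x \<in> totatives ?q" for x
    using totatives_less[OF that one_less_power[of 2 e]] e by simp
  have split: "totatives ?q = A 1 \<union> A 3" "A 1 \<inter> A 3 = {}"
  proof -
    have "x mod 4 = 1 \<or> x mod 4 = 3" if "odd x" for x :: nat using that by presburger
    thus "totatives ?q = A 1 \<union> A 3" using odd_A by (auto simp: A_def)
  qed (auto simp: A_def)
  have "(\<Sum>x \<in> totatives ?q. ?f x) = (\<Sum>x \<in> A 1. ?f x) + (\<Sum>x \<in> A 3. ?f x)"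
    unfolding split(1) by (rule sum.union_disjoint) (use split(2) in \<open>simp_all add: A_def\<close>)
  also have "(\<Sum>x \<in> A 3. ?f x) = (\<Sum>y \<in> A 1. f' y)"
  proof (rule sum.reindex_bij_witness[of _ "\<lambda>y. ?q - y" "\<lambda>x. ?q - x"])
    have tot: "?q - x \<in> totatives ?q" if "x \<in> totatives ?q" for x
      using lt[OF that] odd_A[OF that] e by (auto simp: in_totatives_iff)
    obtain Q where Q: "?q = 4 * Q" using q by blast
    fix x assume x: "x \<in> A 3"
    hence xq: "x \<in> totatives ?q" "x < ?q" "x > 0" "x mod 4 = 3" using lt by (auto simp: A_def in_totatives_iff)
    show "?q - x \<in> A 1"
    proof -
      have "(4 * Q - x) mod 4 = 1" using minus_mod_4[of x Q] xq(2,4) Q by simp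
      thus ?thesis using tot[OF xq(1)] by (simp add: A_def Q)
    qed
    show "?q - (?q - x) = x" using xq by simp
    show "f' (?q - x) = ?f x"
      unfolding f'_def fix_weight_def
    proof (intro prod.cong refl arg_cong2[where f = "(^)"])
      fix t assume t: "t \<in> {1..n}"
      show "(if odd t then 2 else gcd ((?q - x) ^ t - 1) ?q) = gcd (x ^ t - 1) ?q"
      proof (cases "odd t")
        case True
        then obtain s where s: "t = 2 * s + 1" by (elim oddE)
        have "x ^ 2 mod 4 = 1" using xq(4) power_mod[of x 4 2] by (simp add: power2_eq_square)
        hence "(x ^ 2) ^ s mod 4 = 1" using power_mod[of "x ^ 2" 4 s] by simp
        hence "(x * (x ^ 2) ^ s) mod 4 = 3" using xq(4) by (metis mod_mult_eq mult.right_neutral mod_mod_trivial)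
        hence "x ^ t mod 4 = 3" by (simp add: s power_mult)
        then obtain w where "x ^ t = 4 * w + 3" by (metis mult_div_mod_eq)
        hence "x ^ t - 1 = 2 * (2 * w + 1)" by simp
        moreover have "?q = 2 * 2 ^ (e - 1)" using e by (simp flip: power_Suc)
        ultimately have "gcd (x ^ t - 1) ?q = 2 * gcd (2 * w + 1) (2 ^ (e - 1))"
          by (metis gcd_mult_distrib_nat)
        also have "gcd (2 * w + 1) (2 ^ (e - 1)) = 1" by (simp flip: coprime_iff_gcd_eq_1)
        finally show ?thesis using True by simp
      next
        case False
        then obtain s where s: "t = 2 * s" by blast
        have "[int (?q - x) ^ 2 = int x ^ 2] (mod int ?q)"
        proof -
          have "int (?q - x) ^ 2 - int x ^ 2 = int ?q * (int ?q - 2 * int x)"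
            using xq(2) by (simp add: of_nat_diff power2_eq_square algebra_simps)
          thus ?thesis by (simp add: cong_iff_dvd_diff)
        qed
        hence "[(?q - x) ^ 2 = x ^ 2] (mod ?q)" by (simp flip: cong_int_iff)
        hence "[((?q - x) ^ 2) ^ s = (x ^ 2) ^ s] (mod ?q)" by (rule cong_pow)
        hence "[(?q - x) ^ t - 1 = x ^ t - 1] (mod ?q)"
          using xq by (intro cong_diff_nat) (auto simp: s power_mult Suc_le_eq)
        thus ?thesis using False cong_gcd_eq by auto
      qed
    qed
  next
    obtain Q where Q: "?q = 4 * Q" using q by blast
    fix y assume y: "y \<in> A 1"
    hence yq: "y \<in> totatives ?q" "y < ?q" "y > 0" "y mod 4 = 1" using lt by (auto simp: A_def in_totatives_iff)
    show "?q - (?q - y) = y" using yq by simp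
    have "(4 * Q - y) mod 4 = 3" using minus_mod_4[of y Q] yq(2,4) Q by simp
    moreover have "?q - y \<in> totatives ?q"
      using yq(2) odd_A[OF yq(1)] e by (auto simp: in_totatives_iff)
    ultimately show "?q - y \<in> A 3" by (simp add: A_def Q)
  qed
  also have "(\<Sum>x \<in> A 1. ?f x) = (\<Sum>k = 2..e. totient (2 ^ (e - k)) * 4 ^ fexp n 2 e k 1 l)"
    unfolding A_def
  proof (rule sum_totatives_1_mod_4)
    fix z k assume k: "2 \<le> k" "k \<le> e" "gcd z ?q = 2 ^ k"
    have "?f (1 + z) = (\<Prod>t = 1..n. 4 ^ (l t * min e (k + multiplicity 2 t)))"
      unfolding fix_weight_def
      by (intro prod.cong refl)
        (use k in \<open>auto simp: gcd_power_one_plus[unfolded One_nat_def plus_nat.simps] four_power simp flip: power_mult intro: arg_cong\<close>)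
    thus "?f (1 + z) = 4 ^ fexp n 2 e k 1 l"
      using k e by (simp only: fexp_two_one power_sum)
  qed (use e in simp)
  also have "(\<Sum>x \<in> A 1. f' x) = (\<Sum>k = 2..e. totient (2 ^ (e - k)) * 4 ^ fexp n 2 e k 2 l)"
    unfolding A_def
  proof (rule sum_totatives_1_mod_4)
    fix z k assume k: "2 \<le> k" "k \<le> e" "gcd z ?q = 2 ^ k"
    have "f' (1 + z) = (\<Prod>t = 1..n. 4 ^ (l t * (if odd t then 1 else min e (k + multiplicity 2 t))))"
      unfolding f'_def
      by (intro prod.cong refl)
        (use k in \<open>auto simp: gcd_power_one_plus[unfolded One_nat_def plus_nat.simps] four_power simp flip: power_mult intro: arg_cong\<close>)
    thus "f' (1 + z) = 4 ^ fexp n 2 e k 2 l"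
      using k e by (simp only: fexp_two_two power_sum)
  qed (use e in simp)
  moreover have "{1..2::nat} = {1, 2}" by auto
  ultimately show ?thesis by (simp add: sum.distrib)
qed

section \<open>Cyclic groups\<close>

text \<open>After cancelling the gcd, the solutions are the multiples of
  \<open>m div gcd k m\<close> below \<open>m\<close>.\<close>

lemma card_multiples_solutions:
  fixes k m :: nat
  assumes "m > 0"
  shows "card {i \<in> {..<m}. m dvd i * k} = gcd k m"
proof -
  define g where "g = gcd k m"
  have "gcd k m \<noteq> 0" using assms by simp
  from gcd_coprime_exists[OF this] obtain k' m' where km: "k = k' * g" "m = m' * g" "coprime k' m'"
    unfolding g_def by blast
  have g: "g > 0" "m' > 0" using assms km(2) by (auto intro!: Nat.gr0I)
  have "m dvd i * k \<longleftrightarrow> m' dvd i" for i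
  proof -
    have "m dvd i * k \<longleftrightarrow> m' * g dvd (i * k') * g" by (simp add: km(1,2) mult.assoc)
    also have "\<dots> \<longleftrightarrow> m' dvd i * k'" using g by simp
    also have "\<dots> \<longleftrightarrow> m' dvd i" using km(3) by (intro coprime_dvd_mult_left_iff) (simp add: coprime_commute)
    finally show ?thesis .
  qed
  hence "{i \<in> {..<m}. m dvd i * k} = (\<lambda>j. m' * j) ` {..<g}"
    using g by (auto simp: km(2) elim!: dvdE)
  moreover have "inj_on (\<lambda>j. m' * j) {..<g}" using g by (auto simp: inj_on_def)
  ultimately show ?thesis by (simp add: card_image g_def)
qed

context group
begin

lemma nat_pow_eq_iff_cong:
  fixes i j :: nat
  assumes "a \<in> carrier G"
  shows "a [^] i = a [^] j \<longleftrightarrow> [i = j] (mod ord a)"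
proof -
  have "a [^] i = a [^] j \<longleftrightarrow> int (ord a) dvd int j - int i"
    using int_pow_eq[OF assms, of "int i" "int j"] by (simp add: int_pow_int)
  thus ?thesis by (metis cong_iff_dvd_diff cong_int_iff cong_sym)
qed

lemma powers_eq_image:
  assumes "a \<in> carrier G" "ord a > 0"
  shows "range (\<lambda>i::nat. a [^] i) = (\<lambda>i. a [^] i) ` {..<ord a}"
proof -
  have "a [^] i = a [^] (i mod ord a)" for i :: nat
    using assms(1) by (simp add: nat_pow_eq_iff_cong)
  with assms(2) show ?thesis by (auto intro!: image_eqI[of _ _ "_ mod ord a"])
qed

lemma inj_on_powers:
  assumes "a \<in> carrier G"
  shows "inj_on (\<lambda>i::nat. a [^] i) {..<ord a}"
  using assms by (auto simp: inj_on_def nat_pow_eq_iff_cong dest: cong_less_modulus_unique_nat)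

text \<open>Stated for the powers of \<open>a\<close> rather than the whole group, so that it
  applies both to \<open>G\<close> and to the roots of unity in the field.\<close>

lemma card_pow_eq_one:
  assumes "a \<in> carrier G" "ord a > 0"
  shows "card {y \<in> range (\<lambda>i::nat. a [^] i). y [^] (k::nat) = \<one>} = gcd k (ord a)"
proof -
  have "{y \<in> range (\<lambda>i::nat. a [^] i). y [^] k = \<one>} = (\<lambda>i. a [^] i) ` {i \<in> {..<ord a}. ord a dvd i * k}"
    using assms by (auto simp: powers_eq_image nat_pow_pow pow_eq_id)
  moreover have "inj_on (\<lambda>i::nat. a [^] i) {i \<in> {..<ord a}. ord a dvd i * k}"
    by (rule inj_on_subset[OF inj_on_powers[OF assms(1)]]) auto
  ultimately show ?thesis using card_multiples_solutions[OF assms(2), of k] by (simp add: card_image)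
qed

lemma pow_eq_self_iff:
  assumes "x \<in> carrier G" "u > 0"
  shows "x [^] (u::nat) = x \<longleftrightarrow> x [^] (u - 1) = \<one>"
proof -
  have "x [^] u = x [^] (u - 1) \<otimes> x" using assms(2) by (cases u) auto
  thus ?thesis using assms(1) by simp
qed

lemma finite_cyclic_generator:
  assumes "finite (carrier G)" "cyclic_group G"
  obtains a where "a \<in> carrier G" "carrier G = range (\<lambda>i::nat. a [^] i)" "ord a = order G"
proof -
  obtain a where a: "a \<in> carrier G" "subgroup_generated G {a} = G"
    using assms(2) unfolding cyclic_group_def by blast
  have "carrier (subgroup_generated G {a}) = generate G {a}"
    using a(1) by (simp add: carrier_subgroup_generated)
  hence "carrier G = range (\<lambda>i::nat. a [^] i)"
    using a generate_pow_on_finite_carrier[OF assms(1) a(1)] by auto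
  moreover have "ord a = order G" using cyclic_order_is_ord[OF a(1)] a(2) by simp
  ultimately show thesis using that a(1) by blast
qed

end

section \<open>Roots of unity, automorphisms and characters\<close>

text \<open>The powers of \<open>\<zeta>\<close> are already \<open>m\<close> solutions, and a
  polynomial of degree \<open>m\<close> over a field has no more roots.\<close>

lemma (in field) roots_of_unity_eq_powers:
  assumes \<zeta>: "\<zeta> \<in> carrier (mult_of R)" and m: "group.ord (mult_of R) \<zeta> = m" "m > 0"
  shows "{z \<in> carrier (mult_of R). z [^]\<^bsub>mult_of R\<^esub> m = \<one>\<^bsub>mult_of R\<^esub>} = range (\<lambda>i::nat. \<zeta> [^]\<^bsub>mult_of R\<^esub> i)"
proof -
  interpret M: group "mult_of R" by (rule field_mult_group)
  \<comment> \<open>The coefficient list of \<open>X ^ m - 1\<close>, leading coefficient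
    first.\<close>
  define P where "P = \<one> # (replicate (m - 1) \<zero> @ [\<ominus> \<one>])"
  have p: "P \<in> carrier (poly_ring R)"
    by (auto simp: P_def sym[OF univ_poly_carrier] polynomial_def)
  have "x \<in># roots P" if "x \<in> carrier R" "x [^] m = \<one>" for x
  proof -
    have "eval P x = x [^] m \<ominus> \<one>"
      using that(1) m(2) unfolding P_def by (simp only: eval.simps list.sel) (simp add: eval_replicate a_minus_def)
    also have "\<dots> = \<zero>" using that by simp
    finally show ?thesis
      unfolding roots_mem_iff_is_root[OF p] is_root_def using that(1) by (simp add: P_def del: eval.simps)
  qed
  hence sub: "{z \<in> carrier (mult_of R). z [^]\<^bsub>mult_of R\<^esub> m = \<one>\<^bsub>mult_of R\<^esub>} \<subseteq> set_mset (roots P)"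
    by (auto simp: Multiplicative_Group.nat_pow_mult_of)
  have "card {z \<in> carrier (mult_of R). z [^]\<^bsub>mult_of R\<^esub> m = \<one>\<^bsub>mult_of R\<^esub>} \<le> card (set_mset (roots P))"
    by (rule card_mono[OF _ sub]) simp
  also have "\<dots> \<le> size (roots P)"
    unfolding size_multiset_overloaded_eq card_eq_sum by (intro sum_mono) (simp add: Suc_le_eq)
  also have "\<dots> \<le> degree P" by (rule size_roots_le_degree[OF p])
  also have "length P = Suc m" using m(2) by (simp add: P_def)
  hence "degree P = m" by simp
  finally have le: "card {z \<in> carrier (mult_of R). z [^]\<^bsub>mult_of R\<^esub> m = \<one>\<^bsub>mult_of R\<^esub>} \<le> m" .
  have card: "card (range (\<lambda>i::nat. \<zeta> [^]\<^bsub>mult_of R\<^esub> i)) = m"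
    using M.inj_on_powers[OF \<zeta>] m by (simp add: M.powers_eq_image[OF \<zeta>] card_image)
  have "range (\<lambda>i::nat. \<zeta> [^]\<^bsub>mult_of R\<^esub> i) = {z \<in> carrier (mult_of R). z [^]\<^bsub>mult_of R\<^esub> m = \<one>\<^bsub>mult_of R\<^esub>}"
  proof (rule card_seteq)
    show "range (\<lambda>i::nat. \<zeta> [^]\<^bsub>mult_of R\<^esub> i) \<subseteq> {z \<in> carrier (mult_of R). z [^]\<^bsub>mult_of R\<^esub> m = \<one>\<^bsub>mult_of R\<^esub>}"
      using M.nat_pow_closed[OF \<zeta>] m(1)
      by (intro image_subsetI CollectI conjI) (simp_all only: M.nat_pow_pow[OF \<zeta>] M.pow_eq_id[OF \<zeta>] dvd_triv_right)
  qed (use le card finite_subset[OF sub] in simp_all)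
  thus ?thesis ..
qed

context group
begin

definition power_map :: "nat \<Rightarrow> 'a \<Rightarrow> 'a" where
  "power_map u = (\<lambda>x \<in> carrier G. x [^] u)"

text \<open>An automorphism is determined by the exponent \<open>u\<close> of its value at a
  generator, and the inverse automorphism supplies an inverse of \<open>u\<close> modulo the
  order.\<close>

lemma bij_betw_power_map:
  assumes "finite (carrier G)" "cyclic_group G"
  shows "bij_betw power_map (totatives (order G)) (auto G)"
proof -
  obtain a where a: "a \<in> carrier G" and gen: "carrier G = range (\<lambda>i::nat. a [^] i)" and ord: "ord a = order G"
    using finite_cyclic_generator[OF assms] .
  interpret comm_group G by (rule cyclic_imp_abelian_group[OF assms(2)])
  let ?m = "order G"
  have m: "?m > 0" using assms(1) by (simp add: order_gt_0_iff_finite)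
  have cong: "x [^] i = x [^] j" if "x \<in> carrier G" "[i = j] (mod ?m)" for x and i j :: nat
    using that by (simp add: nat_pow_eq_iff_cong cong_dvd_modulus_nat ord_dvd_group_order)
  show ?thesis
  proof (rule bij_betwI')
    fix u v assume uv: "u \<in> totatives ?m" "v \<in> totatives ?m"
    show "power_map u = power_map v \<longleftrightarrow> u = v"
    proof
      assume "power_map u = power_map v"
      hence "a [^] u = a [^] v" using a by (metis power_map_def restrict_apply')
      hence "[u = v] (mod ?m)" using a ord by (simp add: nat_pow_eq_iff_cong)
      thus "u = v" using uv by (cases "u = ?m"; cases "v = ?m")
        (auto simp: in_totatives_iff cong_def dest: le_neq_implies_less)
    qed auto
  next
    fix u assume u: "u \<in> totatives ?m"
    then obtain v where v: "[u * v = Suc 0] (mod ?m)"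
      using cong_solve_coprime_nat[of u ?m] by (auto simp: in_totatives_iff)
    have inv: "(x [^] u) [^] v = x" "(x [^] v) [^] u = x" if "x \<in> carrier G" for x
      using cong[OF that v] that by (simp_all add: nat_pow_pow mult.commute)
    have "bij_betw (power_map u) (carrier G) (carrier G)"
      by (rule bij_betw_byWitness[where f' = "\<lambda>x. x [^] v"]) (auto simp: inv power_map_def)
    moreover have "power_map u \<in> hom G G"
      by (auto simp: hom_def power_map_def nat_pow_distrib)
    ultimately show "power_map u \<in> auto G" by (auto simp: auto_def Bij_def power_map_def)
  next
    fix f assume f: "f \<in> auto G"
    interpret f: group_hom G G f
      using f by unfold_locales (auto simp: auto_def)
    obtain u0 where "f a = a [^] (u0::nat)" using gen auto_closed[OF f a] by blast
    \<comment> \<open>\<open>totatives\<close> takes its residues from 1 to the modulus, so residue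
      0 is represented by \<open>?m\<close>.\<close>
    moreover define u where "u = (if u0 mod ?m = 0 then ?m else u0 mod ?m)"
    have "[u0 = u] (mod ?m)" by (auto simp: u_def cong_def)
    ultimately have u: "f a = a [^] u" using cong[OF a] by simp
    obtain v where "(inv\<^bsub>AutoGroup G\<^esub> f) a = a [^] (v::nat)"
      using gen auto_closed[OF auto_inv(1)[OF f] a] by blast
    hence "a = f (a [^] v)" using auto_inv(2)[OF f a] by simp
    also have "\<dots> = a [^] (u * v)" using a u by (simp add: f.hom_nat_pow nat_pow_pow)
    finally have "a [^] (1::nat) = a [^] (u * v)" using a by simp
    hence "[u * v = 1] (mod ?m)" using a ord by (simp only: nat_pow_eq_iff_cong cong_sym_eq)
    hence "coprime u ?m" by (auto simp: coprime_iff_invertible_nat)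
    moreover have "u > 0" "u \<le> ?m" using m mod_less_divisor[OF m, of u0] by (auto simp: u_def)
    ultimately have "u \<in> totatives ?m" by (simp add: in_totatives_iff)
    moreover have "f = power_map u"
    proof (rule extensionalityI[of _ "carrier G"])
      fix x assume x: "x \<in> carrier G"
      then obtain i :: nat where i: "x = a [^] i" using gen by blast
      show "f x = power_map u x"
        using a x u by (simp add: i power_map_def f.hom_nat_pow nat_pow_pow mult.commute)
    qed (use f in \<open>auto simp: auto_def Bij_def power_map_def\<close>)
    ultimately show "\<exists>u \<in> totatives ?m. f = power_map u" by blast
  qed
qed

lemma power_map_pow:
  assumes "power_map u \<in> auto G"
  shows "power_map u [^]\<^bsub>AutoGroup G\<^esub> (t::nat) = power_map (u ^ t)"
proof (induction t)
  case 0
  show ?case by (auto simp: AutoGroup_simps power_map_def)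
next
  case (Suc t)
  interpret A: group "AutoGroup G" by (rule AutoGroup)
  have "power_map u [^]\<^bsub>AutoGroup G\<^esub> t \<in> auto G"
    using A.nat_pow_closed[of "power_map u" t] assms by (simp add: AutoGroup_simps)
  with Suc assms have "power_map u [^]\<^bsub>AutoGroup G\<^esub> Suc t = compose (carrier G) (power_map (u ^ t)) (power_map u)"
    by (simp add: AutoGroup_simps)
  also have "\<dots> = power_map (u ^ Suc t)"
    by (auto simp: compose_def power_map_def nat_pow_pow mult.commute)
  finally show ?case .
qed

lemma card_power_map_fixed_points:
  assumes "finite (carrier G)" "cyclic_group G" "u > 0"
  shows "card {x \<in> carrier G. power_map u x = x} = gcd (u - 1) (order G)"
proof -
  obtain a where a: "a \<in> carrier G" and gen: "carrier G = range (\<lambda>i::nat. a [^] i)" and ord: "ord a = order G"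
    using finite_cyclic_generator[OF assms(1,2)] .
  have "{x \<in> carrier G. power_map u x = x} = {x \<in> carrier G. x [^] (u - 1) = \<one>}"
    using assms(3) by (auto simp: power_map_def pow_eq_self_iff)
  also have "card \<dots> = gcd (u - 1) (order G)"
    using card_pow_eq_one[OF a, of "u - 1"] assms(1) unfolding gen[symmetric] ord
    by (simp add: order_gt_0_iff_finite)
  finally show ?thesis .
qed

text \<open>The value at the generator fixes a character by multiplicativity; conversely
  \<open>a [^] i\<close> can be sent to the \<open>i\<close>-th power of \<open>z\<close>, since the
  order of \<open>z\<close> divides \<open>ord a\<close>.\<close>

lemma bij_betw_characters:
  fixes F :: "('f, 'c) ring_scheme"
  assumes "field F" and a: "a \<in> carrier G" and gen: "carrier G = range (\<lambda>i::nat. a [^] i)" and m: "ord a > 0"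
  defines "M \<equiv> mult_of F"
  shows "bij_betw (\<lambda>\<chi>. \<chi> a) (characters G F) {z \<in> carrier M. z [^]\<^bsub>M\<^esub> ord a = \<one>\<^bsub>M\<^esub>}"
proof (rule bij_betwI')
  interpret F: field F by fact
  interpret M: group M unfolding M_def by (rule F.field_mult_group)
  have pow: "\<chi> (a [^] i) = \<chi> a [^]\<^bsub>M\<^esub> i" if "\<chi> \<in> characters G F" for \<chi> and i :: nat
  proof -
    interpret group_hom G M \<chi>
      using that by unfold_locales (simp add: characters_def M_def)
    show ?thesis using a by (simp add: hom_nat_pow)
  qed
  {
    fix \<chi> \<chi>' assume \<chi>: "\<chi> \<in> characters G F" "\<chi>' \<in> characters G F"
    show "\<chi> a = \<chi>' a \<longleftrightarrow> \<chi> = \<chi>'"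
    proof
      assume eq: "\<chi> a = \<chi>' a"
      show "\<chi> = \<chi>'"
      proof (rule extensionalityI[of _ "carrier G"])
        fix x assume "x \<in> carrier G"
        then obtain i :: nat where "x = a [^] i" using gen by blast
        thus "\<chi> x = \<chi>' x" using pow[OF \<chi>(1), of i] pow[OF \<chi>(2), of i] eq by simp
      qed (use \<chi> in \<open>auto simp: characters_def\<close>)
    qed auto
  next
    fix \<chi> assume \<chi>: "\<chi> \<in> characters G F"
    interpret group_hom G M \<chi>
      using \<chi> by unfold_locales (simp add: characters_def M_def)
    have "\<chi> a [^]\<^bsub>M\<^esub> ord a = \<one>\<^bsub>M\<^esub>" using pow[OF \<chi>, of "ord a"] a by simp
    moreover have "\<chi> a \<in> carrier M" using a by simp
    ultimately show "\<chi> a \<in> {z \<in> carrier M. z [^]\<^bsub>M\<^esub> ord a = \<one>\<^bsub>M\<^esub>}" by simp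
  next
    fix z assume "z \<in> {z \<in> carrier M. z [^]\<^bsub>M\<^esub> ord a = \<one>\<^bsub>M\<^esub>}"
    hence z: "z \<in> carrier M" "M.ord z dvd ord a" using M.pow_eq_id by auto
    \<comment> \<open>A chosen discrete logarithm to the base \<open>a\<close>. The choice is
      harmless: it is unique modulo \<open>ord a\<close>, which \<open>M.ord z\<close>
      divides.\<close>
    define log where "log x = (SOME i::nat. x = a [^] i)" for x
    have log: "a [^] log x = x" if "x \<in> carrier G" for x
      unfolding log_def using that gen by (metis (mono_tags, lifting) imageE someI_ex)
    have z_pow: "z [^]\<^bsub>M\<^esub> log (a [^] i) = z [^]\<^bsub>M\<^esub> i" for i :: nat
    proof -
      have "a [^] log (a [^] i) = a [^] i" using a by (intro log) simp
      thus ?thesis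
        using a z by (auto simp: nat_pow_eq_iff_cong M.nat_pow_eq_iff_cong intro: cong_dvd_modulus_nat)
    qed
    define \<chi> where "\<chi> = (\<lambda>x \<in> carrier G. z [^]\<^bsub>M\<^esub> log x)"
    have "\<chi> \<in> hom G M"
    proof (rule homI)
      fix x y assume xy: "x \<in> carrier G" "y \<in> carrier G"
      hence "x \<otimes> y = a [^] (log x + log y)" using a log by (simp flip: nat_pow_mult)
      hence "z [^]\<^bsub>M\<^esub> log (x \<otimes> y) = z [^]\<^bsub>M\<^esub> (log x + log y)" using z_pow by simp
      thus "\<chi> (x \<otimes> y) = \<chi> x \<otimes>\<^bsub>M\<^esub> \<chi> y" using xy z by (simp add: \<chi>_def M.nat_pow_mult)
    qed (use z in \<open>simp add: \<chi>_def\<close>)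
    hence "\<chi> \<in> characters G F" by (simp add: characters_def M_def \<chi>_def)
    moreover have "z = \<chi> a" using a z z_pow[of 1] by (simp add: \<chi>_def)
    ultimately show "\<exists>\<chi> \<in> characters G F. z = \<chi> a" by blast
  }
qed

text \<open>Evaluation at a generator identifies the characters with the powers of
  \<open>\<zeta>\<close>, and invariance under the power map turns into a condition on the
  \<open>(u - 1)\<close>-th power, so the count is again one in a cyclic group of order
  \<open>order G\<close>.\<close>

lemma card_power_map_fixed_characters:
  fixes F :: "('f, 'c) ring_scheme"
  assumes fin: "finite (carrier G)" and cyc: "cyclic_group G" and F: "field F"
    and \<zeta>: "\<zeta> \<in> carrier (mult_of F)" "group.ord (mult_of F) \<zeta> = order G"
  shows "finite (characters G F)"
    and "u > 0 \<Longrightarrow> card {\<chi> \<in> characters G F. compose (carrier G) \<chi> (power_map u) = \<chi>} = gcd (u - 1) (order G)"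
proof -
  obtain a where a: "a \<in> carrier G" and gen: "carrier G = range (\<lambda>i::nat. a [^] i)" and ord: "ord a = order G"
    using finite_cyclic_generator[OF fin cyc] .
  interpret F: field F by fact
  let ?M = "mult_of F"
  interpret M: group ?M by (rule F.field_mult_group)
  have m: "order G > 0" using fin by (simp add: order_gt_0_iff_finite)
  define Z where "Z = range (\<lambda>i::nat. \<zeta> [^]\<^bsub>?M\<^esub> i)"
  have bij: "bij_betw (\<lambda>\<chi>. \<chi> a) (characters G F) Z"
    using bij_betw_characters[OF F a gen] F.roots_of_unity_eq_powers[OF \<zeta> m] m
    by (simp add: ord Z_def del: carrier_mult_of one_mult_of)
  have "finite Z" using M.powers_eq_image[OF \<zeta>(1)] \<zeta>(2) m by (simp add: Z_def)
  thus "finite (characters G F)" using bij bij_betw_finite by blast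
  assume u: "u > 0"
  have fixed_iff: "compose (carrier G) \<chi> (power_map u) = \<chi> \<longleftrightarrow> \<chi> a [^]\<^bsub>?M\<^esub> (u - 1) = \<one>\<^bsub>?M\<^esub>"
    if \<chi>: "\<chi> \<in> characters G F" for \<chi>
  proof -
    interpret h: group_hom G ?M \<chi>
      using \<chi> by unfold_locales (simp add: characters_def)
    have "compose (carrier G) \<chi> (power_map u) = \<chi> \<longleftrightarrow> (\<forall>x \<in> carrier G. \<chi> (x [^] u) = \<chi> x)"
      using \<chi> by (auto simp: characters_def compose_def power_map_def fun_eq_iff extensional_def)
    also have "\<dots> \<longleftrightarrow> (\<forall>x \<in> carrier G. \<chi> x [^]\<^bsub>?M\<^esub> u = \<chi> x)"
      by (simp add: h.hom_nat_pow)
    also have "\<dots> \<longleftrightarrow> \<chi> a [^]\<^bsub>?M\<^esub> u = \<chi> a"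
    proof
      assume *: "\<chi> a [^]\<^bsub>?M\<^esub> u = \<chi> a"
      show "\<forall>x \<in> carrier G. \<chi> x [^]\<^bsub>?M\<^esub> u = \<chi> x"
      proof
        fix x assume "x \<in> carrier G"
        then obtain i :: nat where i: "x = a [^] i" using gen by blast
        have \<chi>a: "\<chi> a \<in> carrier ?M" using a by (rule h.hom_closed)
        have "\<chi> x [^]\<^bsub>?M\<^esub> u = (\<chi> a [^]\<^bsub>?M\<^esub> u) [^]\<^bsub>?M\<^esub> i"
          unfolding i h.hom_nat_pow[OF a] M.nat_pow_pow[OF \<chi>a] by (simp only: mult.commute)
        also have "\<dots> = \<chi> x" unfolding * i h.hom_nat_pow[OF a] ..
        finally show "\<chi> x [^]\<^bsub>?M\<^esub> u = \<chi> x" .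
      qed
    qed (use a in blast)
    also have "\<dots> \<longleftrightarrow> \<chi> a [^]\<^bsub>?M\<^esub> (u - 1) = \<one>\<^bsub>?M\<^esub>"
      by (rule M.pow_eq_self_iff[OF h.hom_closed[OF a] u])
    finally show ?thesis .
  qed
  have "bij_betw (\<lambda>\<chi>. \<chi> a) {\<chi> \<in> characters G F. compose (carrier G) \<chi> (power_map u) = \<chi>}
      {z \<in> Z. z [^]\<^bsub>?M\<^esub> (u - 1) = \<one>\<^bsub>?M\<^esub>}"
    using bij fixed_iff by (auto simp: bij_betw_def inj_on_def simp del: carrier_mult_of one_mult_of)
  hence "card {\<chi> \<in> characters G F. compose (carrier G) \<chi> (power_map u) = \<chi>}
      = card {z \<in> Z. z [^]\<^bsub>?M\<^esub> (u - 1) = \<one>\<^bsub>?M\<^esub>}"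
    by (rule bij_betw_same_card)
  also have "\<dots> = gcd (u - 1) (order G)"
    using M.card_pow_eq_one[OF \<zeta>(1), of "u - 1"] \<zeta>(2) m by (simp add: Z_def)
  finally show "card {\<chi> \<in> characters G F. compose (carrier G) \<chi> (power_map u) = \<chi>} = gcd (u - 1) (order G)" .
qed

section \<open>Counting systems over cyclic groups\<close>

text \<open>For the power map by \<open>u\<close>, the \<open>t\<close>-th power fixes equally many
  elements and characters, namely \<open>gcd (u ^ t - 1) (order G)\<close> of each; hence the square
  in \<open>fix_weight\<close>.\<close>

lemma num_ESC_cyclic:
  fixes F :: "('f, 'c) ring_scheme"
  assumes fin: "finite (carrier G)" and cyc: "cyclic_group G" and F: "field F"
    and \<zeta>: "\<zeta> \<in> carrier (mult_of F)" "group.ord (mult_of F) \<zeta> = order G"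
  shows "real (num_ESC G F n) * real (totient (order G)) =
    (\<Sum>l \<in> cycle_types n. real (\<Sum>u \<in> totatives (order G). fix_weight n l (order G) u) /
       ((\<Prod>t = 1..n. fact (l t)) * (\<Prod>t = 1..n. real t ^ l t)))"
proof -
  let ?m = "order G"
  note bij = bij_betw_power_map[OF fin cyc]
  have "real (num_ESC G F n) * real (totient ?m) = real (num_ESC G F n) * real (card (auto G))"
    using bij_betw_same_card[OF bij] by (simp add: totient_def)
  also have "\<dots> = (\<Sum>l \<in> cycle_types n. \<Sum>f \<in> auto G. \<Prod>t = 1..n.
       real (card {x \<in> carrier G. (f [^]\<^bsub>AutoGroup G\<^esub> t) x = x} *
             card {\<chi> \<in> characters G F. compose (carrier G) \<chi> (f [^]\<^bsub>AutoGroup G\<^esub> t) = \<chi>}) ^ l t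
       / (fact (l t) * real t ^ l t))"
    by (rule num_ESC_burnside[OF fin card_power_map_fixed_characters(1)[OF fin cyc F \<zeta>]])
  also have "\<dots> = (\<Sum>l \<in> cycle_types n. \<Sum>u \<in> totatives ?m. real (fix_weight n l ?m u) /
       ((\<Prod>t = 1..n. fact (l t)) * (\<Prod>t = 1..n. real t ^ l t)))"
  proof (rule sum.cong[OF refl])
    fix l
    have "(\<Prod>t = 1..n. real (card {x \<in> carrier G. (power_map u [^]\<^bsub>AutoGroup G\<^esub> t) x = x} *
             card {\<chi> \<in> characters G F. compose (carrier G) \<chi> (power_map u [^]\<^bsub>AutoGroup G\<^esub> t) = \<chi>}) ^ l t
        / (fact (l t) * real t ^ l t)) =
        real (fix_weight n l ?m u) / ((\<Prod>t = 1..n. fact (l t)) * (\<Prod>t = 1..n. real t ^ l t))"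
      if u: "u \<in> totatives ?m" for u
    proof -
      have "power_map u \<in> auto G" using bij u by (rule bij_betw_apply)
      moreover have "u > 0" using u by (simp add: in_totatives_iff)
      ultimately show ?thesis
        by (simp add: power_map_pow card_power_map_fixed_points[OF fin cyc]
            card_power_map_fixed_characters(2)[OF fin cyc F \<zeta>] fix_weight_def prod_dividef prod.distrib
            power_mult power2_eq_square flip: of_nat_mult)
    qed
    thus "(\<Sum>f \<in> auto G. \<Prod>t = 1..n.
       real (card {x \<in> carrier G. (f [^]\<^bsub>AutoGroup G\<^esub> t) x = x} *
             card {\<chi> \<in> characters G F. compose (carrier G) \<chi> (f [^]\<^bsub>AutoGroup G\<^esub> t) = \<chi>}) ^ l t
       / (fact (l t) * real t ^ l t)) = (\<Sum>u \<in> totatives ?m. real (fix_weight n l ?m u) /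
       ((\<Prod>t = 1..n. fact (l t)) * (\<Prod>t = 1..n. real t ^ l t)))"
      by (subst sum.reindex_bij_betw[OF bij, symmetric]) (rule sum.cong[OF refl])
  qed
  finally show ?thesis by (simp add: sum_divide_distrib)
qed

end

lemma order_sum_group_integer_mod:
  assumes "finite I" "\<And>i. i \<in> I \<Longrightarrow> q i > 0"
  shows "order (sum_group I (\<lambda>i. integer_mod_group (q i))) = (\<Prod>i \<in> I. q i)"
proof -
  have "carrier (sum_group I (\<lambda>i. integer_mod_group (q i))) = (\<Pi>\<^sub>E i \<in> I. {0..<int (q i)})"
    using assms by (subst carrier_sum_group) (auto simp: carrier_integer_mod_group PiE_iff extensional_def)
  thus ?thesis using assms by (simp add: order_def card_PiE)
qed

text \<open>Both the sum over units and the number \<open>totient (order G)\<close> of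
  automorphisms, by which Burnside's lemma divides, are multiplicative, which gives one quotient for
  each prime.\<close>

lemma num_ESC_prime_powers:
  fixes G :: "('a, 'b) monoid_scheme" and F :: "('f, 'c) ring_scheme" and p e :: "nat \<Rightarrow> nat"
  assumes I: "finite I" and p: "\<And>i. i \<in> I \<Longrightarrow> prime (p i)" "inj_on p I" and e: "\<And>i. i \<in> I \<Longrightarrow> 1 \<le> e i"
    and G: "group G" "finite (carrier G)" "cyclic_group G"
    and iso: "G \<cong> sum_group I (\<lambda>i. integer_mod_group (p i ^ e i))"
    and F: "field F" "\<zeta> \<in> carrier (mult_of F)" "group.ord (mult_of F) \<zeta> = order G"
  shows "real (num_ESC G F n) = (\<Sum>l \<in> cycle_types n.
      1 / ((\<Prod>t = 1..n. fact (l t)) * (\<Prod>t = 1..n. real t ^ l t)) *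
      (\<Prod>i \<in> I. real (\<Sum>x \<in> totatives (p i ^ e i). fix_weight n l (p i ^ e i) x) /
         (real (p i) ^ (e i - 1) * (real (p i) - 1))))"
proof -
  interpret group G by fact
  have pos: "p i ^ e i > 0" if "i \<in> I" for i using p(1)[OF that] prime_gt_0_nat by simp
  have cop: "coprime (p i ^ e i) (p j ^ e j)" if "i \<in> I" "j \<in> I" "i \<noteq> j" for i j
    using that p by (simp add: primes_coprime inj_on_eq_iff)
  have order: "order G = (\<Prod>i \<in> I. p i ^ e i)"
    using iso_same_card[OF iso] order_sum_group_integer_mod[OF I, of "\<lambda>i. p i ^ e i"] pos
    by (simp add: order_def)
  \<comment> \<open>\<open>totient_prod_coprime\<close> is applied to the family of prime powers,
    which has to be injective.\<close>
  have inj: "inj_on (\<lambda>i. p i ^ e i) I"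
  proof (rule inj_onI, rule ccontr)
    fix i j assume ij: "i \<in> I" "j \<in> I" "p i ^ e i = p j ^ e j" "i \<noteq> j"
    hence "p i ^ e i = 1" using cop[of i j] by simp
    moreover have "p i ^ e i > 1" using prime_gt_1_nat[OF p(1)[OF ij(1)]] e[OF ij(1)] by (intro one_less_power) auto
    ultimately show False by linarith
  qed
  have pairwise: "pairwise coprime ((\<lambda>i. p i ^ e i) ` I)"
  proof (rule pairwiseI)
    fix x y assume "x \<in> (\<lambda>i. p i ^ e i) ` I" "y \<in> (\<lambda>i. p i ^ e i) ` I" "x \<noteq> y"
    then obtain i j where "i \<in> I" "j \<in> I" "i \<noteq> j" "x = p i ^ e i" "y = p j ^ e j" by blast
    with cop show "coprime x y" by metis
  qed
  have "real (totient (order G)) = (\<Prod>i \<in> I. real (totient (p i ^ e i)))"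
    using totient_prod_coprime[OF pairwise inj] by (simp add: order)
  also have "\<dots> = (\<Prod>i \<in> I. real (p i) ^ (e i - 1) * (real (p i) - 1))"
  proof (rule prod.cong[OF refl])
    fix i assume i: "i \<in> I"
    have "real (p i - 1) = real (p i) - 1" using prime_ge_1_nat[OF p(1)[OF i]] by (simp add: of_nat_diff)
    thus "real (totient (p i ^ e i)) = real (p i) ^ (e i - 1) * (real (p i) - 1)"
      using p(1)[OF i] e[OF i] by (simp add: totient_prime_power)
  qed
  finally have tot: "real (totient (order G)) = (\<Prod>i \<in> I. real (p i) ^ (e i - 1) * (real (p i) - 1))" .
  have S: "real (\<Sum>u \<in> totatives (order G). fix_weight n l (order G) u) =
      (\<Prod>i \<in> I. real (\<Sum>x \<in> totatives (p i ^ e i). fix_weight n l (p i ^ e i) x))" for l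
    unfolding order of_nat_prod [symmetric]
    by (rule arg_cong[where f = real], rule sum_fix_weight_prod[OF I]) (erule pos, erule (2) cop)
  have nz: "real (totient (order G)) \<noteq> 0" using G(2) by (simp add: order_gt_0_iff_finite)
  have "real (num_ESC G F n) = (\<Sum>l \<in> cycle_types n. real (\<Sum>u \<in> totatives (order G). fix_weight n l (order G) u) /
       ((\<Prod>t = 1..n. fact (l t)) * (\<Prod>t = 1..n. real t ^ l t))) / real (totient (order G))"
    using num_ESC_cyclic[OF G(2,3) F, of n] nz by (metis nonzero_mult_div_cancel_right)
  also have "\<dots> = (\<Sum>l \<in> cycle_types n.
      1 / ((\<Prod>t = 1..n. fact (l t)) * (\<Prod>t = 1..n. real t ^ l t)) *
      (real (\<Sum>u \<in> totatives (order G). fix_weight n l (order G) u) / real (totient (order G))))"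
    unfolding sum_divide_distrib by (intro sum.cong refl) simp
  also have "\<dots> = (\<Sum>l \<in> cycle_types n.
      1 / ((\<Prod>t = 1..n. fact (l t)) * (\<Prod>t = 1..n. real t ^ l t)) *
      (\<Prod>i \<in> I. real (\<Sum>x \<in> totatives (p i ^ e i). fix_weight n l (p i ^ e i) x) /
         (real (p i) ^ (e i - 1) * (real (p i) - 1))))"
    unfolding tot prod_dividef S ..
  finally show ?thesis .
qed

theorem theorem3p2:
  fixes G :: "('a, 'b) monoid_scheme" and F :: "('f, 'c) ring_scheme"
    and p e :: "nat \<Rightarrow> nat" and s n :: nat
  assumes "1 \<le> s" and "1 \<le> n"
    and "\<forall>i\<in>{1..s}. Factorial_Ring.prime (p i)"
    and "strict_mono_on {1..s} p"
    and "\<forall>i\<in>{1..s}. 1 \<le> e i"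
    and "group G" and "finite (carrier G)" and "cyclic_group G"
    and "G \<cong> sum_group {1..s} (\<lambda>i. integer_mod_group (p i ^ e i))"
    and "field F"
    and "\<exists>\<zeta>\<in>carrier (mult_of F). group.ord (mult_of F) \<zeta> = Coset.order G"
  shows
    "((\<forall>i\<in>{1..s}. odd (p i)) \<or> (p 1 = 2 \<and> e 1 \<le> 2) \<longrightarrow>
       real (num_ESC G F n) =
         (\<Sum>l \<in> cycle_types n.
            1 / ((\<Prod>t = 1..n. fact (l t)) * (\<Prod>t = 1..n. real t ^ l t)) *
            (\<Prod>i = 1..s.
               (\<Sum>k = 1..e i. \<Sum>d | d dvd p i - 1.
                  real (totient (p i ^ (e i - k) * d)) * real (p i) ^ (2 * fexp n (p i) (e i) k d l))
               / (real (p i) ^ (e i - 1) * (real (p i) - 1)))))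
     \<and>
     (p 1 = 2 \<and> 3 \<le> e 1 \<longrightarrow>
       real (num_ESC G F n) =
         (\<Sum>l \<in> cycle_types n.
            1 / ((\<Prod>t = 1..n. fact (l t)) * (\<Prod>t = 1..n. real t ^ l t)) *
            ((\<Sum>k = 2..e 1. \<Sum>d = 1..2.
                real (totient (2 ^ (e 1 - k))) * 4 ^ fexp n 2 (e 1) k d l)
             / 2 ^ (e 1 - 1)) *
            (\<Prod>i = 2..s.
               (\<Sum>k = 1..e i. \<Sum>d | d dvd p i - 1.
                  real (totient (p i ^ (e i - k) * d)) * real (p i) ^ (2 * fexp n (p i) (e i) k d l))
               / (real (p i) ^ (e i - 1) * (real (p i) - 1)))))"
proof -
  obtain \<zeta> where \<zeta>: "\<zeta> \<in> carrier (mult_of F)" "group.ord (mult_of F) \<zeta> = Coset.order G"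
    using assms(11) by blast
  have prime: "prime (p i)" if "i \<in> {1..s}" for i using assms(3) that by blast
  \<comment> \<open>Every prime after the first exceeds \<open>p 1 \<ge> 2\<close>.\<close>
  have odd: "odd (p i)" if "i \<in> {2..s}" for i
  proof -
    have "p 1 < p i" using assms(4) that by (intro strict_mono_onD[of "{1..s}" p]) auto
    moreover have "p 1 \<ge> 2" using prime[of 1] assms(1) by (intro prime_ge_2_nat) auto
    ultimately show ?thesis using prime[of i] that by (intro prime_odd_nat) auto
  qed
  let ?c = "\<lambda>l. 1 / ((\<Prod>t = 1..n. fact (l t)) * (\<Prod>t = 1..n. real t ^ l t)) :: real"
  let ?S = "\<lambda>l i. real (\<Sum>x \<in> totatives (p i ^ e i). fix_weight n l (p i ^ e i) x)"
  let ?T = "\<lambda>l i. \<Sum>k = 1..e i. \<Sum>d | d dvd p i - 1.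
      real (totient (p i ^ (e i - k) * d)) * real (p i) ^ (2 * fexp n (p i) (e i) k d l)"
  let ?D = "\<lambda>i. real (p i) ^ (e i - 1) * (real (p i) - 1)"
  have num: "real (num_ESC G F n) = (\<Sum>l \<in> cycle_types n. ?c l * (\<Prod>i = 1..s. ?S l i / ?D i))"
    using assms(5) by (intro num_ESC_prime_powers[OF _ prime strict_mono_on_imp_inj_on[OF assms(4)] _ assms(6-10) \<zeta>]) auto
  have ST: "?S l i = ?T l i" if "i \<in> {1..s}" "odd (p i) \<or> e i \<le> 2" for l i
    using sum_fix_weight_primroot[OF prime[OF that(1)] _ that(2), of n l] assms(5) that(1) by simp
  show ?thesis
  proof (intro conjI impI)
    assume *: "(\<forall>i\<in>{1..s}. odd (p i)) \<or> (p 1 = 2 \<and> e 1 \<le> 2)"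
    \<comment> \<open>Only the first prime can be 2, and the assumption covers it in both of its
      cases.\<close>
    have "odd (p i) \<or> e i \<le> 2" if "i \<in> {1..s}" for i
    proof (cases "i = 1")
      case False
      thus ?thesis using odd[of i] that by simp
    qed (use * that in auto)
    hence "?S l i = ?T l i" if "i \<in> {1..s}" for l i using ST that by blast
    thus "real (num_ESC G F n) = (\<Sum>l \<in> cycle_types n. ?c l * (\<Prod>i = 1..s. ?T l i / ?D i))"
      unfolding num by (intro sum.cong prod.cong refl arg_cong2[where f = "(*)"] arg_cong2[where f = "(/)"])
  next
    assume *: "p 1 = 2 \<and> 3 \<le> e 1"
    have S1: "?S l 1 = (\<Sum>k = 2..e 1. \<Sum>d = 1..2. real (totient (2 ^ (e 1 - k))) * 4 ^ fexp n 2 (e 1) k d l)" for l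
      using sum_fix_weight_two_power[of "e 1" n l] * by simp
    have "{1..s} = insert 1 {2..s}" using assms(1) by auto
    \<comment> \<open>For \<open>p 1 = 2\<close> the factor \<open>real (p 1) - 1\<close> of the
      denominator is 1.\<close>
    hence "(\<Prod>i = 1..s. ?S l i / ?D i) = ?S l 1 / 2 ^ (e 1 - 1) * (\<Prod>i = 2..s. ?S l i / ?D i)" for l
      using * by simp
    moreover have "(\<Prod>i = 2..s. ?S l i / ?D i) = (\<Prod>i = 2..s. ?T l i / ?D i)" for l
      using odd by (intro prod.cong refl arg_cong2[where f = "(/)"] ST) auto
    ultimately show "real (num_ESC G F n) = (\<Sum>l \<in> cycle_types n. ?c l *
        ((\<Sum>k = 2..e 1. \<Sum>d = 1..2. real (totient (2 ^ (e 1 - k))) * 4 ^ fexp n 2 (e 1) k d l) / 2 ^ (e 1 - 1)) *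
        (\<Prod>i = 2..s. ?T l i / ?D i))"
      unfolding num S1 by (simp only: mult.assoc)
  qed
qed

end
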